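(* Let $(k_N)_{N\in\mathbb N}$ be a non-decreasing sequence of positive integers with $k_N\le N$, $k_N\to\infty$ and $k_N=O(\sqrt N)$. Let $A_N$ be drawn from the $N\times N$ $(k_N,0)$-checkerboard ensemble, independently for each $N$, let $Z_N$ be the $N\times N$ matrix with $(Z_N)_{ij}=F_n$ if $i\equiv j\equiv n\pmod{k_N}$, $1\le n\le k_N$, and $0$ otherwise, and set $M_N=A_N+k_NZ_N$. Then for every $\epsilon>0$: almost surely $M_N$ has $N-k_N$ eigenvalues of magnitude $O(N^{1/2+\epsilon})$ as $N\to\infty$; and for every $n\in\mathbb N$, almost surely $M_N$ has one eigenvalue of the form $NF_n+O(N^{1/2+\epsilon})$ as $N\to\infty$.
   Context: For $N\in\mathbb N$ and $k_N\le N$, the $N\times N$ $(k_N,0)$-checkerboard ensemble consists of real symmetric matrices $M=(m_{ij})$ with $m_{ij}=0$ if $i\equiv j\pmod{k_N}$ and $m_{ij}=a_{ij}$ otherwise, where $a_{ij}=a_{ji}$ ($i<j$) are i.i.d. real random variables with mean $0$, variance $1$ and finite moments of all orders. $F_n$ denotes the Fibonacci numbers with $F_1=1$, $F_2=2$, $F_{n+1}=F_n+F_{n-1}$. *)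

theory Defs
  imports "HOL-Probability.Probability" "HOL-Library.Landau_Symbols"
    "Jordan_Normal_Form.Char_Poly"
begin

text \<open>Fibonacci numbers with the paper's convention F 1 = 1, F 2 = 2,
  F (n+1) = F n + F (n-1). (The value at 0 is an auxiliary seed, never used.)\<close>
fun fibF :: "nat \<Rightarrow> nat" where
  "fibF 0 = 1"
| "fibF (Suc 0) = 1"
| "fibF (Suc (Suc n)) = fibF (Suc n) + fibF n"

text \<open>Indices are 0-based: row/column i (0 \<le> i < N) corresponds to the paper's index i+1.
  The residue class n in {1..k} of the paper's index i+1 is (i mod k) + 1.\<close>

definition checker_mat :: "nat \<Rightarrow> nat \<Rightarrow> (nat \<Rightarrow> nat \<Rightarrow> real) \<Rightarrow> real mat" where
  "checker_mat N k a = mat N N (\<lambda>(i, j).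
     if i mod k = j mod k then 0 else a (min i j) (max i j))"

definition fib_block_mat :: "nat \<Rightarrow> nat \<Rightarrow> real mat" where
  "fib_block_mat N k = mat N N (\<lambda>(i, j).
     if i mod k = j mod k then real (fibF (i mod k + 1)) else 0)"

definition eig_count :: "real mat \<Rightarrow> real set \<Rightarrow> nat" where
  "eig_count A S = (\<Sum>x \<in> {x. poly (char_poly A) x = 0 \<and> x \<in> S}. order x (char_poly A))"

end

theory Submission
  imports Defs "HOL-Real_Asymp.Real_Asymp"
begin

text \<open>Truncate the entries at a small power of $N$; by Markov's inequality for a high moment almost
  surely no entry is affected for large $N$. Hoeffding's inequality for $x^T A_N x$ and a union bound
  over the points of the grid $(4N)^{-1} Z^N$ of norm at most $\sqrt 2$ then show that
  $A_N$ has operator norm $O(N^{1/2+\epsilon})$ almost surely: there are at most $(8N+1)^N$ such points,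
  and $(8N+1)^N \exp(-c N^{1+\epsilon})$ is summable.
  The matrix $k_N Z_N$ is diagonalized by the indicator vectors of the residue classes and vanishes on
  their orthogonal complement, of dimension $N - k_N$; perturbing by $A_N$ moves the spectrum by at most the norm of $A_N$.\<close>

subsection \<open>Spectral theorem for real symmetric matrices\<close>

unbundle no inner_syntax

text \<open>The entries have moments but no bound, while Hoeffding's inequality asks for bounded
  summands; hence the truncation. Its level T = N^(eps/2) answers two demands. A deviation s =
  N^(1/2+eps) has probability at most 2 exp(-s^2/(68 T^2)), and s^2/T^2 = N^(1+eps) exceeds the
  order N log N of the logarithm of the number of grid points. On the other hand T is a positive
  power of N, so a sufficiently high moment beats the number of entries, at most N^2. Truncation
  destroys the zero mean, but the same moment argument makes the new mean O(N^-2), which compensates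
  the sum of the coefficients multiplying it. A grid of spacing 1/(4N), compared with a net of
  constant spacing, costs only a factor log N in the exponent, and eps absorbs it. The residue
  classes have size N/k_N only up to rounding, so the nonzero eigenvalues of k_N Z_N are N F_n +
  O(k_N F_n); this is where k_N = O(sqrt N) enters. Beyond the spectral theorem, the bulk needs a
  dimension count and each outlier an approximate eigenvector.\<close>

text \<open>Over the complex numbers a root \<open>z\<close> of the characteristic polynomial
  exists, with an eigenvector \<open>v\<close>. The Hermitian form \<open>S\<close> = v* A v equals
  \<open>z\<close> times the positive number \<open>Q\<close>, and symmetry of the real matrix makes
  \<open>S\<close> its own conjugate, so \<open>z\<close> is real.\<close>

lemma symmetric_real_eigenvalue_exists:
  fixes A :: "real mat"
  assumes A: "A \<in> carrier_mat n n" and sym: "transpose_mat A = A" and n: "n > 0"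
  shows "\<exists>e. eigenvalue A e"
proof -
  interpret of_real_poly_hom: map_poly_comm_ring_hom "of_real :: real \<Rightarrow> complex" ..
  let ?B = "map_mat complex_of_real A"
  have B: "?B \<in> carrier_mat n n" using A by simp
  have symij: "A $$ (i,j) = A $$ (j,i)" if "i < n" "j < n" for i j
    using that A sym by (metis carrier_matD index_transpose_mat(1))
  have "degree (char_poly ?B) = n" using degree_monic_char_poly[OF B] by simp
  hence "\<not> constant (poly (char_poly ?B))" using n by (simp add: constant_degree)
  then obtain z where z: "poly (char_poly ?B) z = 0"
    using fundamental_theorem_of_algebra by blast
  hence "eigenvalue ?B z" using eigenvalue_root_char_poly[OF B] by simp
  then obtain v where v: "v \<in> carrier_vec n" "v \<noteq> 0\<^sub>v n" "?B *\<^sub>v v = z \<cdot>\<^sub>v v"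
    unfolding eigenvalue_def eigenvector_def using B by auto
  define S where "S = (\<Sum>i<n. \<Sum>j<n. of_real (A $$ (i,j)) * v $ j * cnj (v $ i))"
  define Q where "Q = (\<Sum>i<n. (cmod (v $ i))\<^sup>2)"
  have row: "(\<Sum>j<n. of_real (A $$ (i,j)) * v $ j) = z * v $ i" if "i < n" for i
  proof -
    have "(?B *\<^sub>v v) $ i = z * v $ i" using v that by simp
    moreover have "(?B *\<^sub>v v) $ i = (\<Sum>j<n. of_real (A $$ (i,j)) * v $ j)"
      using that A v(1) by (simp add: scalar_prod_def lessThan_atLeast0)
    ultimately show ?thesis by simp
  qed
  have "S = (\<Sum>i<n. (\<Sum>j<n. of_real (A $$ (i,j)) * v $ j) * cnj (v $ i))"
    unfolding S_def by (simp add: sum_distrib_right)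
  also have "\<dots> = (\<Sum>i<n. z * of_real ((cmod (v $ i))\<^sup>2))"
    by (intro sum.cong refl) (simp only: row lessThan_iff complex_norm_square mult.assoc)
  finally have S1: "S = z * of_real Q" by (simp add: Q_def sum_distrib_left)
  have "cnj S = (\<Sum>i<n. \<Sum>j<n. of_real (A $$ (i,j)) * cnj (v $ j) * v $ i)"
    unfolding S_def by simp
  also have "\<dots> = (\<Sum>j<n. \<Sum>i<n. of_real (A $$ (i,j)) * cnj (v $ j) * v $ i)"
    by (rule sum.swap)
  also have "\<dots> = S" unfolding S_def
    by (intro sum.cong refl) (simp add: symij mult.assoc mult.commute)
  finally have "cnj S = S" .
  hence "cnj z * of_real Q = z * of_real Q" by (simp add: S1)
  moreover have "Q > 0"
  proof -
    obtain i where "i < n" "v $ i \<noteq> 0" using v(1,2)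
      by (metis carrier_vecD eq_vecI index_zero_vec)
    thus ?thesis unfolding Q_def by (intro sum_pos2[of _ i]) auto
  qed
  ultimately have "cnj z = z" by simp
  then obtain r where r: "z = of_real r" by (metis Reals_cnj_iff Reals_cases)
  have "of_real (poly (char_poly A) r) = (0::complex)"
    using z unfolding r of_real_hom.char_poly_hom[OF A] by simp
  hence "poly (char_poly A) r = 0" by simp
  thus ?thesis using eigenvalue_root_char_poly[OF A] by blast
qed

lemma scalar_prod_self_sum: "x \<in> carrier_vec n \<Longrightarrow> x \<bullet> x = (\<Sum>i<n. (x $ i)\<^sup>2)" for x :: "'a :: comm_ring_1 vec"
  by (simp add: scalar_prod_def lessThan_atLeast0 power2_eq_square)

lemma scalar_prod_self_pos:
  fixes x :: "real vec"
  assumes "x \<in> carrier_vec n" "x \<noteq> 0\<^sub>v n"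
  shows "x \<bullet> x > 0"
proof -
  obtain i where "i < n" "x $ i \<noteq> 0" using assms
    by (metis carrier_vecD eq_vecI index_zero_vec)
  thus ?thesis unfolding scalar_prod_self_sum[OF assms(1)] by (intro sum_pos2[of _ i]) auto
qed

text \<open>The Householder reflection interchanging the unit vectors \<^term>\<open>v\<close> and \<^term>\<open>unit_vec n 0\<close>.
  If they agree then \<^term>\<open>2 / (w \<bullet> w) = 0\<close> and the formula yields the identity.\<close>
lemma householder_exists:
  fixes v :: "real vec"
  assumes v: "v \<in> carrier_vec n" "v \<bullet> v = 1" and n: "n > 0"
  obtains H where "H \<in> carrier_mat n n" "transpose_mat H = H" "H * H = 1\<^sub>m n" "H *\<^sub>v v = unit_vec n 0"
proof -
  define w where "w = v - unit_vec n 0"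
  define c where "c = 2 / (w \<bullet> w)"
  define H where "H = mat n n (\<lambda>(i,j). (if i = j then 1 else 0) - c * w $ i * w $ j)"
  have w: "w \<in> carrier_vec n" using v by (simp add: w_def)
  have H: "H \<in> carrier_mat n n" by (simp add: H_def)
  have Ht: "transpose_mat H = H" by (rule eq_matI) (auto simp: H_def)
  have ww: "w \<bullet> w = (\<Sum>i<n. (w $ i)\<^sup>2)" by (rule scalar_prod_self_sum[OF w])
  have cw: "c * (c * (w \<bullet> w)) = 2 * c" by (simp add: c_def)
  have Hx: "H *\<^sub>v x = x - (c * (w \<bullet> x)) \<cdot>\<^sub>v w" if x: "x \<in> carrier_vec n" for x
  proof (rule eq_vecI)
    fix i assume "i < dim_vec (x - (c * (w \<bullet> x)) \<cdot>\<^sub>v w)"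
    hence i: "i < n" using w x by simp
    have "(H *\<^sub>v x) $ i = (\<Sum>j<n. ((if i = j then 1 else 0) - c * w $ i * w $ j) * x $ j)"
      using i x by (simp add: H_def scalar_prod_def lessThan_atLeast0)
    also have "\<dots> = (\<Sum>j<n. (if i = j then x $ j else 0)) - c * w $ i * (\<Sum>j<n. w $ j * x $ j)"
      by (simp add: left_diff_distrib sum_subtractf sum_distrib_left mult.assoc if_distrib[of "\<lambda>t. t * _"] cong: if_cong)
    also have "\<dots> = x $ i - c * w $ i * (w \<bullet> x)"
      using i x by (simp add: scalar_prod_def lessThan_atLeast0)
    finally show "(H *\<^sub>v x) $ i = (x - (c * (w \<bullet> x)) \<cdot>\<^sub>v w) $ i" using i w x by simp
  qed (use w x H in auto)
  have HH: "H * H = 1\<^sub>m n"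
  proof (rule eq_matI)
    fix i j assume "i < dim_row (1\<^sub>m n :: real mat)" "j < dim_col (1\<^sub>m n :: real mat)"
    hence ij: "i < n" "j < n" by auto
    have colj: "col H j = unit_vec n j - (c * w $ j) \<cdot>\<^sub>v w"
      by (rule eq_vecI) (use ij w in \<open>auto simp: H_def\<close>)
    have "(H * H) $$ (i,j) = (H *\<^sub>v col H j) $ i" using ij H by simp
    also have "\<dots> = (col H j - (c * (w \<bullet> col H j)) \<cdot>\<^sub>v w) $ i" using ij H by (subst Hx) auto
    also have "w \<bullet> col H j = w $ j - c * w $ j * (w \<bullet> w)"
      unfolding colj using w ij by (subst scalar_prod_minus_distrib[of _ n]) auto
    also have "(col H j - (c * (w $ j - c * w $ j * (w \<bullet> w))) \<cdot>\<^sub>v w) $ i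
        = (if i = j then 1 else 0) - 2 * c * w $ i * w $ j + (c * (c * (w \<bullet> w))) * w $ i * w $ j"
      unfolding colj using ij w by (simp add: algebra_simps)
    also have "\<dots> = (1\<^sub>m n :: real mat) $$ (i,j)" unfolding cw using ij by simp
    finally show "(H * H) $$ (i,j) = (1\<^sub>m n :: real mat) $$ (i,j)" .
  qed (use H in auto)
  have "H *\<^sub>v v = unit_vec n 0"
  proof -
    have wv: "w \<bullet> v = 1 - v $ 0" unfolding w_def
      using v n by (subst minus_scalar_prod_distrib[of _ n]) auto
    have "w \<bullet> w = w \<bullet> v - w \<bullet> unit_vec n 0" using v w
      by (subst (2) w_def, subst scalar_prod_minus_distrib[of _ n]) auto
    also have "\<dots> = 2 * (w \<bullet> v)" unfolding wv using n v by (simp add: w_def)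
    \<comment> \<open>As \<open>v\<close> and the first unit vector have equal length, their
      products with the difference \<open>w\<close> are opposite. This gives
      \<open>c * (w \<bullet> v) = 1\<close> whenever \<open>w\<close> is nonzero, so the reflection
      subtracts exactly \<open>w\<close> from \<open>v\<close>.\<close>
    finally have w2: "w \<bullet> w = 2 * (w \<bullet> v)" .
    have "(c * (w \<bullet> v)) \<cdot>\<^sub>v w = w"
    proof (cases "w = 0\<^sub>v n")
      case False
      from scalar_prod_self_pos[OF w this] have "c * (w \<bullet> v) = 1" using w2 by (simp add: c_def)
      thus ?thesis by simp
    qed auto
    hence "H *\<^sub>v v = v - w" by (simp add: Hx v)
    also have "\<dots> = unit_vec n 0" using v by (auto simp: w_def intro!: eq_vecI)
    finally show ?thesis .
  qed
  with that H Ht HH show thesis by blast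
qed

definition diagonal_of :: "nat \<Rightarrow> (nat \<Rightarrow> real) \<Rightarrow> real mat" where
  "diagonal_of n d = mat n n (\<lambda>(i,j). if i = j then d i else 0)"

lemma diagonal_of_carrier [simp]: "diagonal_of n d \<in> carrier_mat n n"
  by (simp add: diagonal_of_def)

text \<open>Deflation by induction on the size: a reflection \<open>H\<close> moves a unit
  eigenvector to the first unit vector, so the first column of \<open>B = H * A * H\<close> vanishes
  below the corner, and by symmetry so does the first row. The remaining block \<open>C\<close> is
  symmetric and falls under the induction hypothesis; \<open>H\<close> times the block sum of 1 and
  \<open>V\<close> diagonalizes \<open>A\<close>.\<close>

lemma symmetric_orthogonal_diagonalization:
  fixes A :: "real mat"
  assumes "A \<in> carrier_mat n n" "transpose_mat A = A"
  shows "\<exists>U d. U \<in> carrier_mat n n \<and> transpose_mat U * U = 1\<^sub>m n \<and> U * transpose_mat U = 1\<^sub>m n \<and>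
           A = U * diagonal_of n d * transpose_mat U"
  using assms
proof (induction n arbitrary: A)
  case 0
  thus ?case by (intro exI[of _ "1\<^sub>m 0"] exI[of _ "\<lambda>_. 0"]) (auto simp: diagonal_of_def intro!: eq_matI)
next
  case (Suc m)
  let ?n = "Suc m"
  note A = Suc.prems(1) and At = Suc.prems(2)
  obtain e where "eigenvalue A e" using symmetric_real_eigenvalue_exists[OF A At] by auto
  then obtain u where u: "u \<in> carrier_vec ?n" "u \<noteq> 0\<^sub>v ?n" "A *\<^sub>v u = e \<cdot>\<^sub>v u"
    unfolding eigenvalue_def eigenvector_def using A by auto
  define v where "v = (1 / sqrt (u \<bullet> u)) \<cdot>\<^sub>v u"
  have upos: "u \<bullet> u > 0" by (rule scalar_prod_self_pos[OF u(1,2)])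
  have v: "v \<in> carrier_vec ?n" "v \<bullet> v = 1" "A *\<^sub>v v = e \<cdot>\<^sub>v v"
    using u upos A by (auto simp: v_def mult_mat_vec smult_smult_assoc mult.commute)
  obtain H where H: "H \<in> carrier_mat ?n ?n" "transpose_mat H = H" "H * H = 1\<^sub>m ?n" "H *\<^sub>v v = unit_vec ?n 0"
    using householder_exists[OF v(1,2)] by auto
  define B where "B = H * A * H"
  have B: "B \<in> carrier_mat ?n ?n" using H A by (simp add: B_def)
  have Bt: "transpose_mat B = B" unfolding B_def using H(1,2) A At
    by (simp add: transpose_mult[of _ ?n ?n _ ?n] assoc_mult_mat[of _ ?n ?n _ ?n _ ?n])
  have He: "H *\<^sub>v unit_vec ?n 0 = v"
  proof -
    have "H *\<^sub>v unit_vec ?n 0 = (H * H) *\<^sub>v v" using H(1) v(1)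
      unfolding H(4)[symmetric] by (subst assoc_mult_mat_vec) auto
    thus ?thesis using H(3) v(1) by simp
  qed
  have "B *\<^sub>v unit_vec ?n 0 = H *\<^sub>v (A *\<^sub>v v)"
    unfolding B_def He[symmetric] using H(1) A by (simp add: assoc_mult_mat_vec[of _ ?n ?n _ ?n])
  also have "\<dots> = e \<cdot>\<^sub>v unit_vec ?n 0" unfolding v(3) using H v(1) by (simp add: mult_mat_vec)
  finally have Be: "B *\<^sub>v unit_vec ?n 0 = e \<cdot>\<^sub>v unit_vec ?n 0" .
  have Bcol: "B $$ (i,0) = (if i = 0 then e else 0)" if "i < ?n" for i
  proof -
    have "B $$ (i,0) = (B *\<^sub>v unit_vec ?n 0) $ i" using that B by simp
    thus ?thesis unfolding Be using that by simp
  qed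
  have Brow: "B $$ (0,i) = (if i = 0 then e else 0)" if "i < ?n" for i
    using Bcol[OF that] Bt B that by (metis carrier_matD index_transpose_mat(1) zero_less_Suc)
  define C where "C = mat m m (\<lambda>(i,j). B $$ (Suc i, Suc j))"
  have C: "C \<in> carrier_mat m m" by (simp add: C_def)
  have Ct: "transpose_mat C = C"
  proof (rule eq_matI)
    fix i j assume "i < dim_row C" "j < dim_col C"
    hence ij: "i < m" "j < m" by (auto simp: C_def)
    hence "B $$ (Suc j, Suc i) = transpose_mat B $$ (Suc i, Suc j)" using B by simp
    thus "transpose_mat C $$ (i,j) = C $$ (i,j)" using ij unfolding Bt by (simp add: C_def)
  qed (auto simp: C_def)
  define E where "E = mat 1 1 (\<lambda>_. e)"
  have E: "E \<in> carrier_mat 1 1" by (simp add: E_def)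
  have Bblock: "B = four_block_mat E (0\<^sub>m 1 m) (0\<^sub>m m 1) C"
  proof (rule eq_matI)
    fix i j assume ij: "i < dim_row (four_block_mat E (0\<^sub>m 1 m) (0\<^sub>m m 1) C)" "j < dim_col (four_block_mat E (0\<^sub>m 1 m) (0\<^sub>m m 1) C)"
    thus "B $$ (i,j) = four_block_mat E (0\<^sub>m 1 m) (0\<^sub>m m 1) C $$ (i,j)"
      using Bcol[of i] Brow[of j] by (cases i; cases j) (auto simp: E_def C_def)
  qed (use B in \<open>auto simp: E_def C_def\<close>)
  obtain V d where V: "V \<in> carrier_mat m m" "transpose_mat V * V = 1\<^sub>m m" "V * transpose_mat V = 1\<^sub>m m"
     and Cd: "C = V * diagonal_of m d * transpose_mat V"
    using Suc.IH[OF C Ct] by blast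
  define W where "W = four_block_mat (1\<^sub>m 1) (0\<^sub>m 1 m) (0\<^sub>m m 1) V"
  define d' where "d' = (\<lambda>i. case i of 0 \<Rightarrow> e | Suc i \<Rightarrow> d i)"
  have W: "W \<in> carrier_mat ?n ?n" unfolding W_def using V(1) four_block_carrier_mat[of "1\<^sub>m 1" 1 1 V m m] by simp
  have Wt: "transpose_mat W = four_block_mat (1\<^sub>m 1) (0\<^sub>m 1 m) (0\<^sub>m m 1) (transpose_mat V)"
    unfolding W_def using V(1) by (subst transpose_four_block_mat[where ?nr1.0=1 and ?nc1.0=1 and ?nr2.0=m and ?nc2.0=m]) auto
  have one: "four_block_mat (1\<^sub>m 1) (0\<^sub>m 1 m) (0\<^sub>m m 1) (1\<^sub>m m) = (1\<^sub>m ?n :: real mat)"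
    by (rule eq_matI) auto
  have dd: "diagonal_of ?n d' = four_block_mat E (0\<^sub>m 1 m) (0\<^sub>m m 1) (diagonal_of m d)"
    by (rule eq_matI) (auto simp: diagonal_of_def d'_def E_def split: nat.splits)
  have mult: "four_block_mat X (0\<^sub>m 1 m) (0\<^sub>m m 1) Y * four_block_mat X' (0\<^sub>m 1 m) (0\<^sub>m m 1) Y'
      = four_block_mat (X * X') (0\<^sub>m 1 m) (0\<^sub>m m 1) (Y * Y')"
    if "X \<in> carrier_mat 1 1" "X' \<in> carrier_mat 1 1" "Y \<in> carrier_mat m m" "Y' \<in> carrier_mat m m" for X X' Y Y' :: "real mat"
    using that by (subst mult_four_block_mat[where ?nr1.0=1 and ?n1.0=1 and ?nr2.0=m and ?n2.0=m and ?nc1.0=1 and ?nc2.0=m]) auto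
  have Vt: "transpose_mat V \<in> carrier_mat m m" using V by simp
  have I1: "1\<^sub>m 1 * 1\<^sub>m 1 = (1\<^sub>m 1 :: real mat)" by simp
  have WtW: "transpose_mat W * W = 1\<^sub>m ?n" unfolding Wt unfolding W_def by (subst mult[OF one_carrier_mat one_carrier_mat]) (use V in \<open>simp_all add: one[simplified]\<close>)
  have WWt: "W * transpose_mat W = 1\<^sub>m ?n" unfolding Wt unfolding W_def by (subst mult[OF one_carrier_mat one_carrier_mat]) (use V in \<open>simp_all add: one[simplified]\<close>)
  have P1: "four_block_mat (1\<^sub>m 1) (0\<^sub>m 1 m) (0\<^sub>m m 1) V * four_block_mat E (0\<^sub>m 1 m) (0\<^sub>m m 1) (diagonal_of m d)
      = four_block_mat E (0\<^sub>m 1 m) (0\<^sub>m m 1) (V * diagonal_of m d)"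
    using V E by (subst mult) simp_all
  have P2: "four_block_mat E (0\<^sub>m 1 m) (0\<^sub>m m 1) (V * diagonal_of m d) * four_block_mat (1\<^sub>m 1) (0\<^sub>m 1 m) (0\<^sub>m m 1) (transpose_mat V)
      = four_block_mat E (0\<^sub>m 1 m) (0\<^sub>m m 1) (V * diagonal_of m d * transpose_mat V)"
    using V E Vt by (subst mult) (auto intro: mult_carrier_mat)
  have BW: "B = W * diagonal_of ?n d' * transpose_mat W"
    unfolding Wt dd Bblock Cd unfolding W_def P1 P2 ..
  define U where "U = H * W"
  have U: "U \<in> carrier_mat ?n ?n" using H W by (simp add: U_def)
  have Ut: "transpose_mat U = transpose_mat W * H" unfolding U_def using H W by (simp add: transpose_mult[of _ ?n ?n _ ?n])
  have D: "diagonal_of ?n d' \<in> carrier_mat ?n ?n" by simp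
  note as = assoc_mult_mat[of _ ?n ?n _ ?n _ ?n]
  have Wt': "transpose_mat W \<in> carrier_mat ?n ?n" using W by simp
  have "transpose_mat U * U = transpose_mat W * ((H * H) * W)" unfolding Ut unfolding U_def using H(1) W Wt' by (simp add: as)
  hence 1: "transpose_mat U * U = 1\<^sub>m ?n" using H(3) W WtW by simp
  have "U * transpose_mat U = H * ((W * transpose_mat W) * H)" unfolding Ut unfolding U_def using H(1) W Wt' by (simp add: as)
  hence 2: "U * transpose_mat U = 1\<^sub>m ?n" using H(1,3) WWt by simp
  have "A = (H * H) * A * (H * H)" unfolding H(3) using A by simp
  also have "\<dots> = H * B * H" unfolding B_def using H(1) A by (simp add: as)
  also have "\<dots> = U * diagonal_of ?n d' * transpose_mat U" unfolding Ut unfolding BW U_def using H(1) W Wt' D by (simp add: as mult_carrier_mat[of _ ?n ?n _ ?n])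
  finally show ?case using U 1 2 by blast
qed


lemma orthogonal_scalar_prod:
  fixes U :: "real mat"
  assumes U: "U \<in> carrier_mat n n" "transpose_mat U * U = 1\<^sub>m n"
    and x: "x \<in> carrier_vec n" and y: "y \<in> carrier_vec n"
  shows "(U *\<^sub>v x) \<bullet> (U *\<^sub>v y) = x \<bullet> y"
proof -
  have "(U *\<^sub>v x) \<bullet> (U *\<^sub>v y) = (transpose_mat U *\<^sub>v (U *\<^sub>v x)) \<bullet> y"
    by (rule transpose_vec_mult_scalar[symmetric]) (use U x y in auto)
  also have "transpose_mat U *\<^sub>v (U *\<^sub>v x) = (transpose_mat U * U) *\<^sub>v x"
    by (rule assoc_mult_mat_vec[symmetric]) (use U x in auto)
  finally show ?thesis using U(2) x by simp
qed

section \<open>Quadratic forms, multiplicities and approximate eigenvectors in an eigenbasis\<close>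

locale orthogonally_diagonalized =
  fixes A U :: "real mat" and d :: "nat \<Rightarrow> real" and n :: nat
  assumes U: "U \<in> carrier_mat n n"
    and UtU: "transpose_mat U * U = 1\<^sub>m n" and UUt: "U * transpose_mat U = 1\<^sub>m n"
    and A_eq: "A = U * diagonal_of n d * transpose_mat U"
begin

lemma Ut: "transpose_mat U \<in> carrier_mat n n"
  using U by simp

lemma A: "A \<in> carrier_mat n n"
  unfolding A_eq using U Ut by (intro mult_carrier_mat[of _ n n]) auto

definition coord :: "real vec \<Rightarrow> real vec" where
  "coord x = transpose_mat U *\<^sub>v x"

lemma coord_carrier [simp]: "coord x \<in> carrier_vec n"
  using Ut by (simp add: coord_def carrier_vecI)

lemma dim_coord [simp]: "dim_vec (coord x) = n"
  using coord_carrier carrier_vecD by blast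

lemma U_coord: "x \<in> carrier_vec n \<Longrightarrow> U *\<^sub>v coord x = x"
  using U Ut UUt unfolding coord_def by (metis assoc_mult_mat_vec one_mult_mat_vec)

lemma coord_U: "y \<in> carrier_vec n \<Longrightarrow> coord (U *\<^sub>v y) = y"
  using U Ut UtU unfolding coord_def by (metis assoc_mult_mat_vec one_mult_mat_vec)

lemma mult_eq:
  assumes x: "x \<in> carrier_vec n"
  shows "A *\<^sub>v x = U *\<^sub>v vec n (\<lambda>i. d i * coord x $ i)"
proof -
  have "A *\<^sub>v x = U *\<^sub>v (diagonal_of n d *\<^sub>v coord x)"
    unfolding A_eq coord_def using U Ut x
    by (simp add: assoc_mult_mat_vec[of _ n n _ n])
  also have "diagonal_of n d *\<^sub>v coord x = vec n (\<lambda>i. d i * coord x $ i)"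
  proof (rule eq_vecI)
    fix i assume "i < dim_vec (vec n (\<lambda>i. d i * coord x $ i))"
    hence i: "i < n" by simp
    have "(diagonal_of n d *\<^sub>v coord x) $ i = (\<Sum>j<n. (if i = j then d i else 0) * coord x $ j)"
      using i by (simp add: diagonal_of_def scalar_prod_def lessThan_atLeast0)
    also have "\<dots> = d i * coord x $ i"
      using i by (simp add: if_distrib[of "\<lambda>t. t * _"] cong: if_cong)
    finally show "(diagonal_of n d *\<^sub>v coord x) $ i = vec n (\<lambda>i. d i * coord x $ i) $ i" using i by simp
  qed (simp add: diagonal_of_def)
  finally show ?thesis .
qed

lemma norm_coord:
  assumes "x \<in> carrier_vec n"
  shows "x \<bullet> x = (\<Sum>i<n. (coord x $ i)\<^sup>2)"
proof -
  have "x \<bullet> x = (U *\<^sub>v coord x) \<bullet> (U *\<^sub>v coord x)" using assms by (simp add: U_coord)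
  thus ?thesis using orthogonal_scalar_prod[OF U UtU, of "coord x" "coord x"] scalar_prod_self_sum[OF coord_carrier]
    by simp
qed

lemma quadratic_form_coord:
  assumes "x \<in> carrier_vec n"
  shows "x \<bullet> (A *\<^sub>v x) = (\<Sum>i<n. d i * (coord x $ i)\<^sup>2)"
proof -
  have "x \<bullet> (A *\<^sub>v x) = (U *\<^sub>v coord x) \<bullet> (U *\<^sub>v vec n (\<lambda>i. d i * coord x $ i))"
    using assms by (simp add: U_coord mult_eq)
  also have "\<dots> = coord x \<bullet> vec n (\<lambda>i. d i * coord x $ i)"
    by (rule orthogonal_scalar_prod[OF U UtU]) auto
  finally show ?thesis by (simp add: scalar_prod_def lessThan_atLeast0 power2_eq_square algebra_simps)
qed

lemma norm_mult_coord:
  assumes "x \<in> carrier_vec n"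
  shows "(A *\<^sub>v x) \<bullet> (A *\<^sub>v x) = (\<Sum>i<n. (d i)\<^sup>2 * (coord x $ i)\<^sup>2)"
  unfolding mult_eq[OF assms] by (subst orthogonal_scalar_prod[OF U UtU])
    (auto simp: scalar_prod_def lessThan_atLeast0 power2_eq_square algebra_simps)

lemma char_poly_eq: "char_poly A = (\<Prod>i<n. [:- d i, 1:])"
proof -
  have "similar_mat A (diagonal_of n d)"
    by (rule similar_matI[of _ _ U "transpose_mat U" n]) (use A U Ut UtU UUt A_eq in auto)
  hence "char_poly A = char_poly (diagonal_of n d)" by (rule char_poly_similar)
  also have "\<dots> = (\<Prod>a\<leftarrow>diag_mat (diagonal_of n d). [:- a, 1:])"
    by (rule char_poly_upper_triangular[of _ n]) (auto simp: diagonal_of_def)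
  also have "diag_mat (diagonal_of n d) = map d [0..<n]"
    by (auto simp: diag_mat_def diagonal_of_def)
  also have "(\<Prod>a\<leftarrow>map d [0..<n]. [:- a, 1:]) = (\<Prod>i<n. [:- d i, 1:])"
    by (simp add: comp_def prod.list_conv_set_nth atLeast0LessThan)
  finally show ?thesis .
qed

lemma eigenvalue_d: "i < n \<Longrightarrow> eigenvalue A (d i)"
  by (subst eigenvalue_root_char_poly[OF A]) (auto simp: char_poly_eq poly_prod)

text \<open>Converts algebraic multiplicities into a count of indices, the form in which dimension
  arguments apply. The order of \<open>x\<close> in the product of linear factors is the number of
  \<open>i\<close> with \<open>d i = x\<close>; exchanging the sums over roots and indices
  finishes.\<close>

lemma eig_count_eq: "eig_count A S = card {i. i < n \<and> d i \<in> S}"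
proof -
  have order: "order x (\<Prod>i<m. [:- d i, 1:]) = (\<Sum>i<m. if d i = x then 1 else 0)" for x m
  proof (induction m)
    case (Suc m)
    have nz: "(\<Prod>i<m. [:- d i, 1:]) \<noteq> 0" by (simp add: prod_zero_iff)
    have "order x [:- d m, 1:] = (if d m = x then 1 else 0)"
      using order_linear_power'[of x "- d m" 0] by auto
    with Suc nz show ?case by (simp add: order_mult prod_zero_iff del: mult_pCons_left mult_pCons_right)
  qed simp
  define R where "R = {x. poly (char_poly A) x = 0 \<and> x \<in> S}"
  have R: "R = d ` {..<n} \<inter> S" by (auto simp: R_def char_poly_eq poly_prod)
  have "eig_count A S = (\<Sum>x\<in>R. \<Sum>i<n. if d i = x then 1 else 0)"
    unfolding eig_count_def R_def by (simp add: char_poly_eq order)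
  also have "\<dots> = (\<Sum>i<n. \<Sum>x\<in>R. if d i = x then 1 else 0)" by (rule sum.swap)
  also have "\<dots> = (\<Sum>i<n. if d i \<in> S then 1 else 0)"
    by (intro sum.cong refl) (auto simp: R)
  also have "\<dots> = card {i. i < n \<and> d i \<in> S}"
    by (simp add: sum.If_cases Int_def)
  finally show ?thesis .
qed

text \<open>An approximate eigenvector locates an eigenvalue: in the eigenbasis the squared residual
  is the sum of \<open>(d i - c)\<^sup>2\<close> times the squared coordinates of \<open>v\<close>.
  If every \<open>d i\<close> were farther than \<open>L\<close> from \<open>c\<close>, this would
  exceed \<open>L\<^sup>2 * (v \<bullet> v)\<close>.\<close>

lemma eigenvalue_near:
  assumes v: "v \<in> carrier_vec n" "v \<noteq> 0\<^sub>v n" and L: "L \<ge> 0"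
    and le: "(A *\<^sub>v v - c \<cdot>\<^sub>v v) \<bullet> (A *\<^sub>v v - c \<cdot>\<^sub>v v) \<le> L\<^sup>2 * (v \<bullet> v)"
  shows "\<exists>e. eigenvalue A e \<and> \<bar>e - c\<bar> \<le> L"
proof (rule ccontr)
  assume "\<not> ?thesis"
  hence big: "\<bar>d i - c\<bar> > L" if "i < n" for i using eigenvalue_d[OF that] by fastforce
  let ?y = "coord v"
  have "A *\<^sub>v v - c \<cdot>\<^sub>v v = U *\<^sub>v vec n (\<lambda>i. d i * ?y $ i) - U *\<^sub>v (c \<cdot>\<^sub>v ?y)"
    using U v by (simp add: mult_eq mult_mat_vec U_coord)
  also have "\<dots> = U *\<^sub>v (vec n (\<lambda>i. d i * ?y $ i) - c \<cdot>\<^sub>v ?y)"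
    using U by (subst mult_minus_distrib_mat_vec) auto
  finally have "(A *\<^sub>v v - c \<cdot>\<^sub>v v) \<bullet> (A *\<^sub>v v - c \<cdot>\<^sub>v v)
     = (vec n (\<lambda>i. d i * ?y $ i) - c \<cdot>\<^sub>v ?y) \<bullet> (vec n (\<lambda>i. d i * ?y $ i) - c \<cdot>\<^sub>v ?y)"
    by (simp add: orthogonal_scalar_prod[OF U UtU])
  also have "\<dots> = (\<Sum>i<n. (d i - c)\<^sup>2 * (?y $ i)\<^sup>2)"
    by (simp add: scalar_prod_def lessThan_atLeast0 power2_eq_square algebra_simps)
  also have "\<dots> > L\<^sup>2 * (v \<bullet> v)"
  proof -
    have sq: "L\<^sup>2 < (d i - c)\<^sup>2" if "i < n" for i
      using big[OF that] L by (metis abs_of_nonneg power2_strict_mono)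
    have "(\<Sum>i<n. (?y $ i)\<^sup>2) > 0" using scalar_prod_self_pos[OF v] norm_coord[OF v(1)] by simp
    then obtain i where i: "i < n" "?y $ i \<noteq> 0"
      by (metis (no_types, lifting) less_irrefl lessThan_iff power_zero_numeral sum.neutral)
    have "(\<Sum>i<n. L\<^sup>2 * (?y $ i)\<^sup>2) < (\<Sum>i<n. (d i - c)\<^sup>2 * (?y $ i)\<^sup>2)"
    proof (rule sum_strict_mono_ex1)
      show "\<forall>i\<in>{..<n}. L\<^sup>2 * (?y $ i)\<^sup>2 \<le> (d i - c)\<^sup>2 * (?y $ i)\<^sup>2"
        by (auto intro!: mult_right_mono less_imp_le[OF sq])
      show "\<exists>i\<in>{..<n}. L\<^sup>2 * (?y $ i)\<^sup>2 < (d i - c)\<^sup>2 * (?y $ i)\<^sup>2"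
        using i sq[OF i(1)] by (intro bexI[of _ i]) (auto intro!: mult_strict_right_mono)
    qed simp
    thus ?thesis by (simp add: norm_coord[OF v(1)] sum_distrib_left)
  qed
  finally show False using le by simp
qed

end

lemma symmetric_orthogonally_diagonalizedE:
  assumes "A \<in> carrier_mat n n" "transpose_mat A = A"
  obtains U d where "orthogonally_diagonalized A U d n"
  using symmetric_orthogonal_diagonalization[OF assms] unfolding orthogonally_diagonalized_def by blast

subsection \<open>Perturbation and the operator norm\<close>

text \<open>The dimension count, done with a determinant: the vectors are the rows of a square
  matrix padded with zero rows. Since the last row is zero, the determinant vanishes and the kernel
  contains a nonzero vector.\<close>

lemma underdetermined_homogeneous_solution:
  fixes rs :: "real vec list"
  assumes rs: "set rs \<subseteq> carrier_vec n" and len: "length rs < n"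
  obtains y where "y \<in> carrier_vec n" "y \<noteq> 0\<^sub>v n" "\<And>r. r \<in> set rs \<Longrightarrow> r \<bullet> y = 0"
proof -
  define M where "M = mat n n (\<lambda>(i,j). if i < length rs then rs ! i $ j else 0)"
  have M: "M \<in> carrier_mat n n" by (simp add: M_def)
  have "transpose_mat M *\<^sub>v unit_vec n (n - 1) = 0\<^sub>v n"
    by (rule eq_vecI) (use len in \<open>auto simp: M_def\<close>)
  moreover have "unit_vec n (n - 1) \<noteq> (0\<^sub>v n :: real vec)" using len by (intro unit_vec_nonzero) simp
  ultimately have "det (transpose_mat M) = 0"
    by (subst det_0_iff_vec_prod_zero[of _ n]) (use M in \<open>auto intro!: exI[of _ "unit_vec n (n - 1)"]\<close>)
  hence "det M = 0" using det_transpose[OF M] by simp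
  then obtain y where y: "y \<in> carrier_vec n" "y \<noteq> 0\<^sub>v n" "M *\<^sub>v y = 0\<^sub>v n"
    using det_0_iff_vec_prod_zero[OF M] by auto
  have "r \<bullet> y = 0" if r: "r \<in> set rs" for r
  proof -
    obtain i where i: "i < length rs" "r = rs ! i" using r by (auto simp: in_set_conv_nth)
    have "dim_vec r = n" using rs r by auto
    hence "row M i = r" using i len by (auto simp: M_def intro!: eq_vecI)
    thus ?thesis using y(3) i len M by (metis index_mult_mat_vec index_zero_vec(1) carrier_matD(1) order.strict_trans)
  qed
  with y that show thesis by blast
qed

text \<open>If too few eigenvalues lay in [-L, L], the span of the other eigenvectors would meet the
  orthogonal complement of \<open>rs\<close> in a nonzero \<open>w\<close>. There
  \<open>A + B\<close> acts as \<open>A\<close>, so it stretches \<open>w\<close> by at most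
  \<open>L\<close>, while every eigencomponent of \<open>w\<close> is stretched by more than
  \<open>L\<close>.\<close>

lemma eig_count_perturbation:
  fixes A B :: "real mat"
  assumes A: "A \<in> carrier_mat n n" and B: "B \<in> carrier_mat n n"
    and sym: "transpose_mat (A + B) = A + B"
    and L: "L \<ge> 0" "\<And>w. w \<in> carrier_vec n \<Longrightarrow> (A *\<^sub>v w) \<bullet> (A *\<^sub>v w) \<le> L\<^sup>2 * (w \<bullet> w)"
    and rs: "set rs \<subseteq> carrier_vec n"
    and ker: "\<And>w. w \<in> carrier_vec n \<Longrightarrow> (\<And>r. r \<in> set rs \<Longrightarrow> r \<bullet> w = 0) \<Longrightarrow> B *\<^sub>v w = 0\<^sub>v n"
  shows "n - length rs \<le> eig_count (A + B) {x. \<bar>x\<bar> \<le> L}"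
proof -
  have AB: "A + B \<in> carrier_mat n n" using A B by simp
  obtain U d where "orthogonally_diagonalized (A + B) U d n"
    using symmetric_orthogonally_diagonalizedE[OF AB sym] .
  then interpret orthogonally_diagonalized "A + B" U d n .
  define S where "S = {i. i < n \<and> \<bar>d i\<bar> \<le> L}"
  have "n \<le> card S + length rs"
  proof (rule ccontr)
    assume less: "\<not> ?thesis"
    define js where "js = sorted_list_of_set S"
    have "finite S" by (simp add: S_def)
    hence iss: "set js = S" "length js = card S" by (auto simp: js_def)
    \<comment> \<open>Both requirements become linear conditions on the eigencoordinates
      \<open>y\<close>: the unit vectors kill the coordinates with
      \<open>\<bar>d i\<bar> \<le> L\<close>, and the vectors \<open>coord r\<close> express
      orthogonality to \<open>rs\<close>. By assumption there are fewer than \<open>n\<close> of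
      them.\<close>
    define rs' where "rs' = map (unit_vec n) js @ map coord rs"
    obtain y where y: "y \<in> carrier_vec n" "y \<noteq> 0\<^sub>v n" "\<And>r. r \<in> set rs' \<Longrightarrow> r \<bullet> y = 0"
    proof (rule underdetermined_homogeneous_solution[of rs' n])
      show "length rs' < n" using less by (simp add: rs'_def iss)
    qed (auto simp: rs'_def)
    have yS: "y $ i = 0" if "i \<in> S" for i
      using y(3)[of "unit_vec n i"] that y(1) by (auto simp: rs'_def iss S_def)
    define w where "w = U *\<^sub>v y"
    have w: "w \<in> carrier_vec n" using U y by (simp add: w_def)
    have cw: "coord w = y" unfolding w_def by (rule coord_U[OF y(1)])
    have "B *\<^sub>v w = 0\<^sub>v n"
    proof (rule ker[OF w])
      fix r assume r: "r \<in> set rs"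
      have "r \<bullet> w = coord r \<bullet> y" unfolding w_def coord_def
        by (rule transpose_vec_mult_scalar[symmetric]) (use U y r rs in auto)
      also have "\<dots> = 0" using y(3)[of "coord r"] r by (auto simp: rs'_def)
      finally show "r \<bullet> w = 0" .
    qed
    hence "(A + B) *\<^sub>v w = A *\<^sub>v w" using assms(1) B w by (simp add: add_mult_distrib_mat_vec[of _ n n])
    hence le: "(\<Sum>i<n. (d i)\<^sup>2 * (y $ i)\<^sup>2) \<le> (\<Sum>i<n. L\<^sup>2 * (y $ i)\<^sup>2)"
      using norm_mult_coord[OF w] L(2)[OF w] norm_coord[OF w] by (simp add: cw sum_distrib_left)
    obtain i where i: "i < n" "y $ i \<noteq> 0" using y(1,2)
      by (metis carrier_vecD eq_vecI index_zero_vec)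
    have sq: "L\<^sup>2 < (d i)\<^sup>2" if "i < n" "i \<notin> S" for i
      using that L(1) power2_strict_mono[of L "d i"] by (simp add: S_def)
    have "(\<Sum>i<n. L\<^sup>2 * (y $ i)\<^sup>2) < (\<Sum>i<n. (d i)\<^sup>2 * (y $ i)\<^sup>2)"
    proof (rule sum_strict_mono_ex1)
      show "\<forall>i\<in>{..<n}. L\<^sup>2 * (y $ i)\<^sup>2 \<le> (d i)\<^sup>2 * (y $ i)\<^sup>2"
      proof
        fix i assume "i \<in> {..<n}"
        thus "L\<^sup>2 * (y $ i)\<^sup>2 \<le> (d i)\<^sup>2 * (y $ i)\<^sup>2"
          using sq[of i] yS[of i] by (cases "i \<in> S") (auto intro!: mult_right_mono)
      qed
      show "\<exists>i\<in>{..<n}. L\<^sup>2 * (y $ i)\<^sup>2 < (d i)\<^sup>2 * (y $ i)\<^sup>2"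
        using i sq[of i] yS by (intro bexI[of _ i]) (auto intro!: mult_strict_right_mono)
    qed simp
    with le show False by simp
  qed
  thus ?thesis by (simp add: eig_count_eq S_def)
qed

section \<open>Discretization of the unit sphere\<close>

text \<open>Confining each coordinate to [-1, 1] loses no rounded unit vector and makes the set
  finite with an explicit count. Extensional functions are used so that distinct elements are
  distinct points. The bound 2, rather than 1, on the squared norm leaves room for the rounding
  error.\<close>

definition grid :: "nat \<Rightarrow> (nat \<Rightarrow> real) set" where
  "grid n = {x \<in> {..<n} \<rightarrow>\<^sub>E (\<lambda>z::int. of_int z / (4 * real n)) ` {- 4 * int n..4 * int n}. (\<Sum>i<n. (x i)\<^sup>2) \<le> 2}"

lemma finite_grid: "finite (grid n)"
  unfolding grid_def by (rule finite_subset[OF _ finite_PiE[of "{..<n}" "\<lambda>_. (\<lambda>z::int. of_int z / (4 * real n)) ` {- 4 * int n..4 * int n}"]]) auto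

lemma card_grid_le: "card (grid n) \<le> (8 * n + 1) ^ n"
proof -
  let ?T = "(\<lambda>z::int. of_int z / (4 * real n)) ` {- 4 * int n..4 * int n}"
  have "card (grid n) \<le> card ({..<n} \<rightarrow>\<^sub>E ?T)"
    unfolding grid_def by (intro card_mono finite_PiE) auto
  also have "\<dots> = card ?T ^ n" by (simp add: card_PiE)
  also have "card ?T \<le> card {- 4 * int n..4 * int n}" by (intro card_image_le) simp
  also have "card {- 4 * int n..4 * int n} = 8 * n + 1" by simp
  finally show ?thesis by (simp add: power_mono)
qed

lemma grid_abs_le:
  assumes "x \<in> grid n" "i < n"
  shows "\<bar>x i\<bar> \<le> 1"
proof -
  obtain z :: int where z: "z \<in> {- 4 * int n..4 * int n}" "x i = of_int z / (4 * real n)"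
    using assms unfolding grid_def by (auto simp: PiE_iff image_iff Ball_def)
  have "\<bar>of_int z :: real\<bar> \<le> of_int (4 * int n)" using z(1)
    by (subst of_int_abs[symmetric], subst of_int_le_iff) auto
  thus ?thesis using z(2) assms(2) by (simp add: abs_divide divide_le_eq_1)
qed

text \<open>Round an eigenvector of the largest absolute eigenvalue to the grid.\<close>
lemma quadratic_form_on_grid_bounds_norm:
  fixes A :: "real mat"
  assumes A: "A \<in> carrier_mat n n" "transpose_mat A = A" and n: "n > 0"
    and t: "\<And>x. x \<in> grid n \<Longrightarrow> \<bar>vec n x \<bullet> (A *\<^sub>v vec n x)\<bar> \<le> t"
    and w: "w \<in> carrier_vec n"
  shows "(A *\<^sub>v w) \<bullet> (A *\<^sub>v w) \<le> (3 * t)\<^sup>2 * (w \<bullet> w)"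
proof -
  obtain U d where "orthogonally_diagonalized A U d n"
    using symmetric_orthogonally_diagonalizedE[OF A] .
  then interpret orthogonally_diagonalized A U d n .
  define m where "m = Max ((\<lambda>i. \<bar>d i\<bar>) ` {..<n})"
  have "m \<in> (\<lambda>i. \<bar>d i\<bar>) ` {..<n}" unfolding m_def by (rule Max_in) (use n in auto)
  then obtain p where p: "p < n" "\<bar>d p\<bar> = m" by auto
  have dm: "\<bar>d i\<bar> \<le> m" if "i < n" for i unfolding m_def using that by (intro Max_ge) auto
  have m0: "m \<ge> 0" using p by auto
  define v where "v = U *\<^sub>v unit_vec n p"
  have v: "v \<in> carrier_vec n" using U by (simp add: v_def)
  have cv: "coord v = unit_vec n p" unfolding v_def by (rule coord_U) simp
  have vv: "(\<Sum>i<n. (v $ i)\<^sup>2) = 1"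
    using scalar_prod_self_sum[OF v] orthogonal_scalar_prod[OF U UtU, of "unit_vec n p" "unit_vec n p"] p
    by (simp add: v_def)
  have v1: "\<bar>v $ i\<bar> \<le> 1" if "i < n" for i
  proof -
    have "(v $ i)\<^sup>2 \<le> (\<Sum>i<n. (v $ i)\<^sup>2)" by (rule member_le_sum) (use that in auto)
    thus ?thesis using vv by (simp add: abs_square_le_1)
  qed
  \<comment> \<open>Rounding down to a multiple of 1/(4n) keeps integer multiples within the range
    allowed by \<open>grid\<close> and changes each coordinate by at most 1/(4n). The error
    \<open>\<delta>\<close> then has squared norm at most 1/16.\<close>
  define z where "z = (\<lambda>i. \<lfloor>4 * real n * v $ i\<rfloor>)"
  define x where "x = (\<lambda>i\<in>{..<n}. of_int (z i) / (4 * real n))"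
  define \<delta> where "\<delta> = vec n x - v"
  have \<delta>: "\<delta> \<in> carrier_vec n" using v by (simp add: \<delta>_def)
  have zb: "z i \<in> {- 4 * int n..4 * int n}" if "i < n" for i
  proof -
    have "\<bar>4 * real n * v $ i\<bar> \<le> 4 * real n * 1"
      unfolding abs_mult using v1[OF that] by (intro mult_mono) auto
    thus ?thesis unfolding z_def by (auto simp: le_floor_iff floor_le_iff)
  qed
  have \<delta>i: "(\<delta> $ i)\<^sup>2 \<le> 1 / (16 * real n)" if "i < n" for i
  proof -
    have "\<delta> $ i = (of_int (z i) - 4 * real n * v $ i) / (4 * real n)"
      using that v n by (simp add: \<delta>_def x_def field_simps)
    moreover have "\<bar>of_int (z i) - 4 * real n * v $ i\<bar> \<le> 1" unfolding z_def by linarith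
    ultimately have "\<bar>\<delta> $ i\<bar> \<le> 1 / (4 * real n)" using n by (simp add: abs_divide divide_right_mono)
    hence "(\<delta> $ i)\<^sup>2 \<le> (1 / (4 * real n))\<^sup>2" by (metis abs_ge_zero power2_abs power_mono)
    also have "\<dots> = 1 / (16 * real n) * (1 / real n)" using n by (simp add: power2_eq_square)
    also have "\<dots> \<le> 1 / (16 * real n) * 1" using n by (intro mult_left_mono) auto
    finally show ?thesis by simp
  qed
  define \<eta> where "\<eta> = coord \<delta>"
  define r where "r = (\<Sum>i<n. (\<eta> $ i)\<^sup>2)"
  have "r = (\<Sum>i<n. (\<delta> $ i)\<^sup>2)"
    unfolding r_def \<eta>_def norm_coord[OF \<delta>, symmetric] by (rule scalar_prod_self_sum[OF \<delta>])
  also have "\<dots> \<le> (\<Sum>i<n. 1 / (16 * real n))" by (intro sum_mono) (use \<delta>i in auto)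
  also have "\<dots> = 1 / 16" using n by simp
  finally have r: "r \<le> 1 / 16" .
  have xv: "vec n x = v + \<delta>" using v by (auto simp: \<delta>_def intro!: eq_vecI)
  have cx: "coord (vec n x) $ i = (if i = p then 1 else 0) + \<eta> $ i" if "i < n" for i
  proof -
    have "coord (vec n x) = unit_vec n p + \<eta>"
      unfolding xv \<eta>_def cv[symmetric] unfolding coord_def
      by (rule mult_add_distrib_mat_vec) (use Ut v \<delta> in auto)
    thus ?thesis using that p by (simp add: \<eta>_def)
  qed
  let ?R = "\<Sum>i\<in>{..<n} - {p}. (\<eta> $ i)\<^sup>2"
  have r_split: "r = (\<eta> $ p)\<^sup>2 + ?R" unfolding r_def using p by (subst sum.remove[of _ p]) auto
  have R0: "?R \<ge> 0" by (intro sum_nonneg) auto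
  have "(\<eta> $ p)\<^sup>2 \<le> (1/4)\<^sup>2" using r r_split R0 by (simp add: power2_eq_square)
  hence \<eta>p: "\<bar>\<eta> $ p\<bar> \<le> 1/4" by (metis abs_le_square_iff abs_of_nonneg zero_le_divide_1_iff zero_le_numeral)
  \<comment> \<open>Only the coordinate \<open>p\<close> of the extremal eigenvalue is large at the
    rounded point; all the others come from the error. The choices \<open>f = 1\<close> and
    \<open>f = d\<close> give its squared norm and its quadratic form.\<close>
  have split: "(\<Sum>i<n. f i * (coord (vec n x) $ i)\<^sup>2) = f p * (1 + \<eta> $ p)\<^sup>2 + (\<Sum>i\<in>{..<n} - {p}. f i * (\<eta> $ i)\<^sup>2)" for f
    using p by (subst sum.remove[of _ p]) (auto simp: cx intro!: sum.cong)
  have "(\<Sum>i<n. (x i)\<^sup>2) = vec n x \<bullet> vec n x" by (subst scalar_prod_self_sum[of _ n]) auto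
  also have "\<dots> = (1 + \<eta> $ p)\<^sup>2 + ?R" using split[of "\<lambda>_. 1"] by (simp add: norm_coord)
  also have "\<dots> = 1 + 2 * \<eta> $ p + r" by (simp add: r_split power2_eq_square algebra_simps)
  also have "\<dots> \<le> 2" using r \<eta>p by linarith
  finally have "x \<in> grid n" unfolding grid_def using zb by (auto simp: x_def)
  hence tx: "\<bar>vec n x \<bullet> (A *\<^sub>v vec n x)\<bar> \<le> t" by (rule t)
  have "\<bar>\<Sum>i\<in>{..<n} - {p}. d i * (\<eta> $ i)\<^sup>2\<bar> \<le> (\<Sum>i\<in>{..<n} - {p}. \<bar>d i * (\<eta> $ i)\<^sup>2\<bar>)" by (rule sum_abs)
  also have "\<dots> \<le> (\<Sum>i\<in>{..<n} - {p}. m * (\<eta> $ i)\<^sup>2)"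
    by (intro sum_mono) (auto simp: abs_mult dm intro!: mult_right_mono)
  also have "\<dots> = m * ?R" by (simp add: sum_distrib_left)
  \<comment> \<open>The other eigenvalues may have the opposite sign, but they are at most
    \<open>m\<close> in magnitude, so they cancel at most \<open>m * ?R\<close> of the main
    term.\<close>
  finally have "\<bar>d p * (1 + \<eta> $ p)\<^sup>2\<bar> - m * ?R \<le> t"
    using tx unfolding quadratic_form_coord[OF vec_carrier] split[of d] by linarith
  moreover have "\<bar>d p * (1 + \<eta> $ p)\<^sup>2\<bar> = m * (1 + \<eta> $ p)\<^sup>2" using p by (simp add: abs_mult)
  ultimately have "m * ((1 + \<eta> $ p)\<^sup>2 - ?R) \<le> t" by (simp add: algebra_simps)
  \<comment> \<open>Writing \<open>?R\<close> as \<open>r\<close> minus the square of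
    \<open>\<eta> $ p\<close> turns the bracket into 2 (eta_p + 1/2)^2 + 1/2 - r, which is at least
    1/2 - 1/16 = 7/16. The weaker value 1/3 is the origin of the factor 3 in the conclusion.\<close>
  moreover have "m * (1/3) \<le> m * ((1 + \<eta> $ p)\<^sup>2 - ?R)"
  proof (rule mult_left_mono[OF _ m0])
    have "0 \<le> 2 * (\<eta> $ p + 1/2)\<^sup>2" by simp
    also have "2 * (\<eta> $ p + 1/2)\<^sup>2 = 2 * (\<eta> $ p)\<^sup>2 + 2 * \<eta> $ p + 1/2" by (simp add: power2_eq_square algebra_simps)
    finally show "1/3 \<le> (1 + \<eta> $ p)\<^sup>2 - ?R" using r r_split by (simp add: power2_eq_square algebra_simps)
  qed
  ultimately have mt: "m \<le> 3 * t" by linarith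
  have "(A *\<^sub>v w) \<bullet> (A *\<^sub>v w) = (\<Sum>i<n. (d i)\<^sup>2 * (coord w $ i)\<^sup>2)" by (rule norm_mult_coord[OF w])
  also have "\<dots> \<le> (\<Sum>i<n. (3 * t)\<^sup>2 * (coord w $ i)\<^sup>2)"
  proof (intro sum_mono mult_right_mono)
    fix i assume "i \<in> {..<n}"
    hence "\<bar>d i\<bar> \<le> 3 * t" using dm[of i] mt by auto
    thus "(d i)\<^sup>2 \<le> (3 * t)\<^sup>2" by (metis abs_ge_zero power2_abs power_mono)
  qed auto
  also have "\<dots> = (3 * t)\<^sup>2 * (w \<bullet> w)" by (simp add: norm_coord[OF w] sum_distrib_left)
  finally show ?thesis .
qed

subsection \<open>Concentration of the quadratic form\<close>

definition upper_pairs :: "nat \<Rightarrow> (nat \<times> nat) set" where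
  "upper_pairs n = {(i, j). i < j \<and> j < n}"

lemma upper_pairs_subset: "upper_pairs n \<subseteq> {..<n} \<times> {..<n}"
  by (auto simp: upper_pairs_def)

lemma finite_upper_pairs [simp]: "finite (upper_pairs n)"
  by (rule finite_subset[OF upper_pairs_subset]) simp

lemma card_upper_pairs_le: "card (upper_pairs n) \<le> n\<^sup>2"
  using card_mono[OF _ upper_pairs_subset, of n] by (simp add: power2_eq_square)

lemma upper_pairs_Suc: "upper_pairs (Suc n) = upper_pairs n \<union> (\<lambda>i. (i, n)) ` {..<n}"
  by (auto simp: upper_pairs_def)

text \<open>Reduces a symmetric quadratic form to one term per unordered pair, that is, per
  independent entry. Passing from \<open>n\<close> to \<open>Suc n\<close> adds a row and a column
  with equal sums, and the corner is zero.\<close>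

lemma sum_symmetric_upper_pairs:
  fixes g :: "nat \<Rightarrow> nat \<Rightarrow> 'a :: comm_semiring_1"
  assumes sym: "\<And>i j. g i j = g j i" and diag: "\<And>i. g i i = 0"
  shows "(\<Sum>i<n. \<Sum>j<n. g i j) = (\<Sum>(i,j)\<in>upper_pairs n. 2 * g i j)"
proof (induction n)
  case 0
  show ?case by (simp add: upper_pairs_def)
next
  case (Suc n)
  have "(\<Sum>(i,j)\<in>upper_pairs (Suc n). 2 * g i j)
      = (\<Sum>(i,j)\<in>upper_pairs n. 2 * g i j) + (\<Sum>(i,j)\<in>(\<lambda>i. (i, n)) ` {..<n}. 2 * g i j)"
    unfolding upper_pairs_Suc by (subst sum.union_disjoint) (simp_all, auto simp: upper_pairs_def)
  also have "(\<Sum>(i,j)\<in>(\<lambda>i. (i, n)) ` {..<n}. 2 * g i j) = (\<Sum>i<n. 2 * g i n)"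
    by (subst sum.reindex) (auto simp: inj_on_def)
  finally show ?case using Suc.IH diag sym[of n]
    by (simp add: sum.distrib mult_2 ac_simps)
qed

text \<open>The weight of the independent entry \<open>a i j\<close> in the quadratic form at
  \<open>x\<close>; the factor 2 is there because the entry occurs in two symmetric
  positions.\<close>

definition checker_coeff :: "nat \<Rightarrow> (nat \<Rightarrow> real) \<Rightarrow> nat \<times> nat \<Rightarrow> real" where
  "checker_coeff k x = (\<lambda>(i, j). if i mod k = j mod k then 0 else 2 * (x i * x j))"

lemma checker_mat_carrier [simp]: "checker_mat n k a \<in> carrier_mat n n"
  by (simp add: checker_mat_def)

lemma transpose_checker_mat: "transpose_mat (checker_mat n k a) = checker_mat n k a"
  by (rule eq_matI) (auto simp: checker_mat_def min.commute max.commute)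

lemma quadratic_form_checker_mat:
  "vec n x \<bullet> (checker_mat n k a *\<^sub>v vec n x) = (\<Sum>(i,j)\<in>upper_pairs n. checker_coeff k x (i,j) * a i j)"
proof -
  define g where "g i j = x i * ((if i mod k = j mod k then 0 else a (min i j) (max i j)) * x j)" for i j
  have "vec n x \<bullet> (checker_mat n k a *\<^sub>v vec n x) = (\<Sum>i<n. \<Sum>j<n. g i j)"
    by (simp add: scalar_prod_def checker_mat_def g_def lessThan_atLeast0 sum_distrib_left)
  also have "\<dots> = (\<Sum>(i,j)\<in>upper_pairs n. 2 * g i j)"
    by (rule sum_symmetric_upper_pairs) (auto simp: g_def min.commute max.commute)
  also have "\<dots> = (\<Sum>(i,j)\<in>upper_pairs n. checker_coeff k x (i,j) * a i j)"
    by (rule sum.cong) (auto simp: g_def checker_coeff_def upper_pairs_def min_def max_def)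
  finally show ?thesis .
qed

text \<open>The squared coefficients sum to at most 4 times the fourth power of the norm of
  \<open>x\<close>, and 16 = 4 * 2 * 2. That this bound depends on neither \<open>n\<close> nor
  \<open>k\<close> is what makes the deviation of the form of order T and not of order nT.\<close>

lemma checker_coeff_sq_sum:
  assumes "x \<in> grid n"
  shows "(\<Sum>p\<in>upper_pairs n. (checker_coeff k x p)\<^sup>2) \<le> 16"
proof -
  have x: "(\<Sum>i<n. (x i)\<^sup>2) \<le> 2" using assms by (simp add: grid_def)
  have "(\<Sum>p\<in>upper_pairs n. (checker_coeff k x p)\<^sup>2) \<le> (\<Sum>(i,j)\<in>upper_pairs n. 4 * ((x i)\<^sup>2 * (x j)\<^sup>2))"
    by (rule sum_mono) (auto simp: checker_coeff_def power_mult_distrib)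
  also have "\<dots> \<le> (\<Sum>(i,j)\<in>{..<n} \<times> {..<n}. 4 * ((x i)\<^sup>2 * (x j)\<^sup>2))"
    by (rule sum_mono2[OF _ upper_pairs_subset]) auto
  also have "\<dots> = 4 * ((\<Sum>i<n. (x i)\<^sup>2) * (\<Sum>i<n. (x i)\<^sup>2))"
    unfolding sum_product by (simp add: sum.cartesian_product[symmetric] sum_distrib_left)
  also have "\<dots> \<le> 4 * (2 * 2)"
    by (intro mult_left_mono mult_mono x) (auto intro!: sum_nonneg)
  finally show ?thesis by simp
qed

text \<open>A crude count of pairs suffices here: this sum will only multiply the mean of a
  truncated entry, which is smaller than any chosen power of 1/n allows for.\<close>

lemma checker_coeff_abs_sum:
  assumes "x \<in> grid n"
  shows "(\<Sum>p\<in>upper_pairs n. \<bar>checker_coeff k x p\<bar>) \<le> 2 * real (n\<^sup>2)"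
proof -
  have "\<bar>checker_coeff k x p\<bar> \<le> 2" if "p \<in> upper_pairs n" for p
  proof -
    obtain i j where p: "p = (i, j)" "i < n" "j < n" using \<open>p \<in> upper_pairs n\<close> by (auto simp: upper_pairs_def)
    have "\<bar>x i\<bar> * \<bar>x j\<bar> \<le> 1 * 1" using p by (intro mult_mono grid_abs_le[OF assms]) auto
    thus ?thesis using p by (simp add: checker_coeff_def abs_mult)
  qed
  hence "(\<Sum>p\<in>upper_pairs n. \<bar>checker_coeff k x p\<bar>) \<le> real (card (upper_pairs n)) * 2"
    by (intro sum_bounded_above) auto
  also have "\<dots> \<le> real (n\<^sup>2) * 2" using card_upper_pairs_le[of n]
    by (intro mult_right_mono of_nat_mono) auto
  finally show ?thesis by simp
qed

section \<open>Truncated entries and tail bounds\<close>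

definition truncate :: "real \<Rightarrow> real \<Rightarrow> real" where
  "truncate T u = (if \<bar>u\<bar> \<le> T then u else 0)"

lemma truncate_measurable [measurable]: "truncate T \<in> borel_measurable borel"
  unfolding truncate_def by measurable

lemma truncate_abs_le: "T \<ge> 0 \<Longrightarrow> \<bar>truncate T u\<bar> \<le> T"
  by (simp add: truncate_def)

text \<open>Since the full mean is zero, the truncated mean is minus the mean of the discarded part.
  The latter lives where \<open>\<bar>x\<bar> > T\<close>, and there \<open>\<bar>x\<bar>\<close> is
  at most \<open>\<bar>x\<bar> ^ Suc p / T ^ p\<close>.\<close>

lemma mean_truncate_le:
  fixes D :: "real measure"
  assumes D: "sets D = sets borel" and mom: "\<And>m. integrable D (\<lambda>x. \<bar>x\<bar> ^ m)"
    and mean: "(\<integral>x. x \<partial>D) = 0" and T: "T > 0"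
  shows "\<bar>\<integral>x. truncate T x \<partial>D\<bar> \<le> (\<integral>x. \<bar>x\<bar> ^ Suc p \<partial>D) / T ^ p"
proof -
  have [measurable_cong]: "sets D = sets borel" by (rule D)
  have int: "integrable D (\<lambda>x. x)"
    using mom[of 1] by (subst integrable_abs_iff[symmetric]) auto
  have intT: "integrable D (truncate T)"
    by (rule Bochner_Integration.integrable_bound[OF int]) (auto simp: truncate_def)
  have pt: "\<bar>x - truncate T x\<bar> \<le> \<bar>x\<bar> ^ Suc p / T ^ p" for x
  proof (cases "\<bar>x\<bar> \<le> T")
    case False
    hence "1 \<le> (\<bar>x\<bar> / T) ^ p" using T by (intro one_le_power) simp
    hence "\<bar>x\<bar> * 1 \<le> \<bar>x\<bar> * (\<bar>x\<bar> / T) ^ p" by (intro mult_left_mono) auto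
    thus ?thesis using False by (simp add: truncate_def power_divide)
  qed (use T in \<open>simp add: truncate_def\<close>)
  have "(\<integral>x. truncate T x \<partial>D) = - (\<integral>x. x - truncate T x \<partial>D)"
    using int intT mean by simp
  hence "\<bar>\<integral>x. truncate T x \<partial>D\<bar> = \<bar>\<integral>x. x - truncate T x \<partial>D\<bar>" by simp
  also have "\<dots> \<le> (\<integral>x. \<bar>x - truncate T x\<bar> \<partial>D)" by (rule integral_abs_bound)
  also have "\<dots> \<le> (\<integral>x. \<bar>x\<bar> ^ Suc p / T ^ p \<partial>D)"
    by (intro integral_mono pt) (use int intT mom[of "Suc p"] in auto)
  finally show ?thesis by simp
qed

context prob_space
begin

text \<open>Serves to pass from the family indexed by triples (N, i, j) to the entries of one
  matrix, indexed by pairs; the index type changes, so restriction to a subset is not enough. Finite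
  subfamilies correspond under \<open>h\<close>, and the events are carried back along its
  inverse.\<close>

lemma indep_vars_reindex:
  assumes h: "inj_on h I" and ind: "indep_vars M' X (h ` I)"
  shows "indep_vars (\<lambda>i. M' (h i)) (\<lambda>i. X (h i)) I"
proof -
  let ?F = "\<lambda>i. {X i -` A \<inter> space M | A. A \<in> sets (M' i)}"
  have rv: "\<And>i. i \<in> I \<Longrightarrow> random_variable (M' (h i)) (X (h i))" and F: "indep_sets ?F (h ` I)"
    using ind unfolding indep_vars_def2 by auto
  have "indep_sets (\<lambda>i. ?F (h i)) I"
  proof (rule indep_setsI)
    fix i assume "i \<in> I"
    thus "?F (h i) \<subseteq> events" using F unfolding indep_sets_def by blast
  next
    fix A J assume J: "J \<noteq> {}" "J \<subseteq> I" "finite J" and A: "\<forall>j\<in>J. A j \<in> ?F (h j)"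
    have inj: "inj_on h J" using h J(2) by (rule inj_on_subset)
    define A' where "A' i = A (the_inv_into J h i)" for i
    have A': "A' (h j) = A j" if "j \<in> J" for j using that inj by (simp add: A'_def the_inv_into_f_f)
    have "prob (\<Inter>i\<in>h ` J. A' i) = (\<Prod>i\<in>h ` J. prob (A' i))"
      by (rule indep_setsD[OF F]) (use J A A' in auto)
    thus "prob (\<Inter>j\<in>J. A j) = (\<Prod>j\<in>J. prob (A j))"
      using A' inj by (simp add: prod.reindex)
  qed
  thus ?thesis using rv unfolding indep_vars_def2 by auto
qed

text \<open>For fixed \<open>x\<close> the form is a sum of independent bounded terms, so
  Hoeffding's inequality applies around its mean, which factors because all entries have the law
  \<open>D\<close>.\<close>

lemma truncated_quadratic_form_tail:
  fixes a :: "nat \<Rightarrow> nat \<Rightarrow> 'a \<Rightarrow> real"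
  assumes ind: "indep_vars (\<lambda>_. borel) (\<lambda>(i,j). a i j) (upper_pairs n)"
    and ident: "\<And>i j. (i,j) \<in> upper_pairs n \<Longrightarrow> distr M borel (a i j) = D"
    and n: "n \<ge> 2" and x: "x \<in> grid n" and T: "T > 0" and s: "s \<ge> 0"
  shows "prob {\<omega>\<in>space M. \<bar>(\<Sum>(i,j)\<in>upper_pairs n. checker_coeff k x (i,j) * truncate T (a i j \<omega>))
            - (\<Sum>p\<in>upper_pairs n. checker_coeff k x p) * (\<integral>u. truncate T u \<partial>D)\<bar> \<ge> s}
         \<le> 2 * exp (- (s\<^sup>2 / (68 * T\<^sup>2)))"
proof -
  let ?I = "upper_pairs n"
  let ?c = "checker_coeff k x"
  define X where "X = (\<lambda>p \<omega>. ?c p * truncate T ((case p of (i,j) \<Rightarrow> a i j) \<omega>))"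
  \<comment> \<open>The natural range is T times the absolute coefficient, but all coefficients can
    vanish, for example at the grid point 0, and Hoeffding's inequality needs a positive sum of
    squared widths. The slack \<open>1 / real n\<close> ensures this; its squares add up to at most
    1 over the pairs.\<close>
  define R where "R = (\<lambda>p. T * (\<bar>?c p\<bar> + 1 / real n))"
  have rv: "a i j \<in> borel_measurable M" if "(i,j) \<in> ?I" for i j
    using ind that unfolding indep_vars_def2 by fastforce
  have indX: "indep_vars (\<lambda>_. borel) X ?I"
    unfolding X_def by (rule indep_vars_compose2[OF ind]) measurable
  have bound: "X p \<omega> \<in> {- R p..R p}" for p \<omega>
  proof -
    have "\<bar>X p \<omega>\<bar> \<le> \<bar>?c p\<bar> * T" unfolding X_def abs_mult
      by (intro mult_left_mono truncate_abs_le) (use T in auto)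
    also have "\<dots> \<le> R p" using T by (simp add: R_def algebra_simps)
    finally show ?thesis by (simp add: abs_le_iff)
  qed
  interpret H: Hoeffding_ineq M ?I X "\<lambda>p. - R p" R "\<Sum>p\<in>?I. expectation (X p)"
    by unfold_locales (use indX bound in auto)
  have Rpos: "R p > 0" for p unfolding R_def using T n by (intro mult_pos_pos add_nonneg_pos) auto
  have "(0, 1) \<in> ?I" using n by (simp add: upper_pairs_def)
  hence pos: "(\<Sum>p\<in>?I. (R p - - R p)\<^sup>2) > 0"
    by (intro sum_pos zero_less_power) (use Rpos in \<open>auto simp: add_pos_pos\<close>)
  have "(\<Sum>p\<in>?I. (R p - - R p)\<^sup>2) \<le> (\<Sum>p\<in>?I. 8 * T\<^sup>2 * ((?c p)\<^sup>2 + 1 / (real n)\<^sup>2))"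
  proof (rule sum_mono)
    fix p
    have "(R p - - R p)\<^sup>2 = 4 * T\<^sup>2 * (\<bar>?c p\<bar> + 1 / real n)\<^sup>2" by (simp add: R_def power_mult_distrib)
    also have "\<dots> \<le> 4 * T\<^sup>2 * (2 * (\<bar>?c p\<bar>\<^sup>2 + (1 / real n)\<^sup>2))"
      using sum_squares_bound[of "\<bar>?c p\<bar>" "1 / real n"] by (intro mult_left_mono) (auto simp: power2_sum)
    finally show "(R p - - R p)\<^sup>2 \<le> 8 * T\<^sup>2 * ((?c p)\<^sup>2 + 1 / (real n)\<^sup>2)" by (simp add: power_divide algebra_simps)
  qed
  also have "\<dots> = 8 * T\<^sup>2 * ((\<Sum>p\<in>?I. (?c p)\<^sup>2) + real (card ?I) / (real n)\<^sup>2)"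
    by (simp add: sum_distrib_left[symmetric] sum.distrib)
  \<comment> \<open>Here 16 bounds the squared coefficients and 1 the slack. The total 136 T^2 turns
    Hoeffding's exponent 2 s^2 / (136 T^2) into s^2 / (68 T^2).\<close>
  also have "\<dots> \<le> 8 * T\<^sup>2 * (16 + 1)"
  proof (intro mult_left_mono add_mono checker_coeff_sq_sum[OF x])
    have "real (card ?I) \<le> (real n)\<^sup>2" using card_upper_pairs_le[of n] by (metis of_nat_mono of_nat_power)
    thus "real (card ?I) / (real n)\<^sup>2 \<le> 1" using n by (simp add: divide_le_eq_1)
  qed auto
  finally have le: "(\<Sum>p\<in>?I. (R p - - R p)\<^sup>2) \<le> 136 * T\<^sup>2" by simp
  have E: "expectation (X p) = ?c p * (\<integral>u. truncate T u \<partial>D)" if p: "p \<in> ?I" for p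
  proof -
    obtain i j where ij: "p = (i, j)" by (cases p)
    have [measurable]: "a i j \<in> borel_measurable M" using rv p ij by simp
    have "(\<integral>u. truncate T u \<partial>D) = (\<integral>\<omega>. truncate T (a i j \<omega>) \<partial>M)"
      using p unfolding ij ident[of i j, symmetric, OF p[unfolded ij]] by (subst integral_distr) auto
    thus ?thesis by (simp add: X_def ij)
  qed
  have Esum: "(\<Sum>p\<in>?I. expectation (X p)) = (\<Sum>p\<in>?I. ?c p) * (\<integral>u. truncate T u \<partial>D)"
    by (simp add: E sum_distrib_right)
  have Xsum: "(\<Sum>(i,j)\<in>?I. ?c (i,j) * truncate T (a i j \<omega>)) = (\<Sum>p\<in>?I. X p \<omega>)" for \<omega>
    by (intro sum.cong) (auto simp: X_def)
  have "prob {\<omega>\<in>space M. \<bar>(\<Sum>p\<in>?I. X p \<omega>) - (\<Sum>p\<in>?I. expectation (X p))\<bar> \<ge> s}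
      \<le> 2 * exp (- 2 * s\<^sup>2 / (\<Sum>p\<in>?I. (R p - - R p)\<^sup>2))"
    by (rule H.Hoeffding_ineq_abs_ge[OF s pos])
  also have "2 * s\<^sup>2 / (136 * T\<^sup>2) \<le> 2 * s\<^sup>2 / (\<Sum>p\<in>?I. (R p - - R p)\<^sup>2)"
    using le pos T by (intro divide_left_mono mult_pos_pos) auto
  hence "2 * exp (- 2 * s\<^sup>2 / (\<Sum>p\<in>?I. (R p - - R p)\<^sup>2)) \<le> 2 * exp (- (s\<^sup>2 / (68 * T\<^sup>2)))"
    by simp
  finally show ?thesis unfolding Xsum Esum .
qed

lemma entries_tail:
  fixes a :: "nat \<Rightarrow> nat \<Rightarrow> 'a \<Rightarrow> real"
  assumes rv: "\<And>i j. (i,j) \<in> upper_pairs n \<Longrightarrow> a i j \<in> borel_measurable M"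
    and ident: "\<And>i j. (i,j) \<in> upper_pairs n \<Longrightarrow> distr M borel (a i j) = D"
    and mom: "integrable D (\<lambda>x. \<bar>x\<bar> ^ p)" and T: "T > 0"
  shows "prob (\<Union>(i,j)\<in>upper_pairs n. {\<omega>\<in>space M. \<bar>a i j \<omega>\<bar> > T}) \<le> (real n)\<^sup>2 * ((\<integral>x. \<bar>x\<bar> ^ p \<partial>D) / T ^ p)"
proof -
  have single: "prob {\<omega>\<in>space M. \<bar>a i j \<omega>\<bar> > T} \<le> (\<integral>x. \<bar>x\<bar> ^ p \<partial>D) / T ^ p" if ij: "(i,j) \<in> upper_pairs n" for i j
  proof -
    have [measurable]: "a i j \<in> borel_measurable M" by (rule rv[OF ij])
    have int: "integrable M (\<lambda>\<omega>. \<bar>a i j \<omega>\<bar> ^ p)"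
      using mom unfolding ident[OF ij, symmetric] by (subst (asm) integrable_distr_eq) auto
    have "prob {\<omega>\<in>space M. \<bar>a i j \<omega>\<bar> > T} \<le> prob {\<omega>\<in>space M. T ^ p \<le> \<bar>a i j \<omega>\<bar> ^ p}"
      by (rule finite_measure_mono) (use T in \<open>auto intro!: power_mono\<close>)
    also have "\<dots> \<le> (\<integral>\<omega>. \<bar>a i j \<omega>\<bar> ^ p \<partial>M) / T ^ p"
      by (rule integral_Markov_inequality_measure[where A = "{}"]) (use int T in auto)
    also have "(\<integral>\<omega>. \<bar>a i j \<omega>\<bar> ^ p \<partial>M) = (\<integral>x. \<bar>x\<bar> ^ p \<partial>D)"
      unfolding ident[OF ij, symmetric] by (subst integral_distr) auto
    finally show ?thesis .
  qed
  have "prob (\<Union>(i,j)\<in>upper_pairs n. {\<omega>\<in>space M. \<bar>a i j \<omega>\<bar> > T})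
      \<le> (\<Sum>(i,j)\<in>upper_pairs n. prob {\<omega>\<in>space M. \<bar>a i j \<omega>\<bar> > T})"
    unfolding case_prod_beta using rv
    by (intro finite_measure_subadditive_finite) (auto simp: prod.split_sel)
  also have "\<dots> \<le> real (card (upper_pairs n)) * ((\<integral>x. \<bar>x\<bar> ^ p \<partial>D) / T ^ p)"
    by (rule sum_bounded_above) (auto intro: single)
  also have "\<dots> \<le> (real n)\<^sup>2 * ((\<integral>x. \<bar>x\<bar> ^ p \<partial>D) / T ^ p)"
  proof (rule mult_right_mono)
    show "real (card (upper_pairs n)) \<le> (real n)\<^sup>2" using card_upper_pairs_le[of n] by (metis of_nat_mono of_nat_power)
  qed (use T in simp)
  finally show ?thesis .
qed

end

section \<open>Almost sure bound on the norm of the checkerboard matrix\<close>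

text \<open>On the logarithmic scale, the grid contributes N ln(8N+1) and the deviation bound
  -N^(1+eps)/68, which dominates. The target 1/N^2 is chosen only because it is summable.\<close>

lemma grid_union_bound_eventually:
  fixes \<epsilon> :: real
  assumes \<epsilon>: "\<epsilon> > 0"
  shows "eventually (\<lambda>N. (8 * real N + 1) ^ N * (2 * exp (- (real N powr (1 + \<epsilon>) / 68))) \<le> 1 / (real N)\<^sup>2) sequentially"
proof -
  have "eventually (\<lambda>N::nat. real N * ln (8 * real N + 1) + ln 2 - real N powr (1 + \<epsilon>) / 68 \<le> - 2 * ln (real N)) sequentially"
    using \<epsilon> by real_asymp
  thus ?thesis using eventually_gt_at_top[of 0]
  proof eventually_elim
    case (elim N)
    have pow: "(8 * real N + 1) ^ N = exp (real N * ln (8 * real N + 1))"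
      by (subst exp_of_nat_mult, subst exp_ln) auto
    have "(8 * real N + 1) ^ N * (2 * exp (- (real N powr (1 + \<epsilon>) / 68)))
        = exp (real N * ln (8 * real N + 1)) * exp (ln 2) * exp (- (real N powr (1 + \<epsilon>) / 68))"
      unfolding pow by simp
    also have "\<dots> = exp (real N * ln (8 * real N + 1) + ln 2 - real N powr (1 + \<epsilon>) / 68)"
      by (simp only: exp_add[symmetric] diff_conv_add_uminus)
    also have "\<dots> \<le> exp (- 2 * ln (real N))" using elim by (subst exp_le_cancel_iff)
    also have "\<dots> = 1 / (real N)\<^sup>2"
    proof -
      have "exp (2 * ln (real N)) = (real N)\<^sup>2"
        using elim exp_of_nat_mult[of 2 "ln (real N)"] by simp
      thus ?thesis by (simp add: exp_minus divide_inverse)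
    qed
    finally show ?case .
  qed
qed

text \<open>Outside the event \<open>Bad N\<close> no entry is truncated and the form at every grid
  point is within \<open>s N\<close> of the mean of its truncated version; rounding extends this to
  all vectors. The probabilities of \<open>Bad N\<close> are summable, so Borel-Cantelli applies.
  The constant \<open>K\<close> does not depend on the sample point.\<close>

lemma (in prob_space) checker_mat_norm_bound:
  fixes a :: "nat \<Rightarrow> nat \<Rightarrow> nat \<Rightarrow> 'a \<Rightarrow> real" and k :: "nat \<Rightarrow> nat" and \<epsilon> :: real
  assumes ind: "\<And>N. indep_vars (\<lambda>_. borel) (\<lambda>(i, j). a N i j) (upper_pairs N)"
    and ident: "\<And>N i j. (i, j) \<in> upper_pairs N \<Longrightarrow> distr M borel (a N i j) = D"
    and mom: "\<And>m. integrable D (\<lambda>x. \<bar>x\<bar> ^ m)"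
    and mean: "(\<integral>x. x \<partial>D) = 0"
    and \<epsilon>: "\<epsilon> > 0"
  obtains K where "K \<ge> 0"
    "AE \<omega> in M. \<forall>\<^sub>F N in sequentially. \<forall>w\<in>carrier_vec N.
       (checker_mat N (k N) (\<lambda>i j. a N i j \<omega>) *\<^sub>v w) \<bullet> (checker_mat N (k N) (\<lambda>i j. a N i j \<omega>) *\<^sub>v w)
         \<le> (K * real N powr (1/2 + \<epsilon>))\<^sup>2 * (w \<bullet> w)"
proof -
  have rv: "a N i j \<in> borel_measurable M" if "(i, j) \<in> upper_pairs N" for N i j
    using ind[of N] that unfolding indep_vars_def2 by fastforce
  have D: "sets D = sets borel"
    using ident[of 0 1 2] by (auto simp: upper_pairs_def)
  define T where "T N = real N powr (\<epsilon> / 2)" for N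
  define s where "s N = real N powr (1/2 + \<epsilon>)" for N
  \<comment> \<open>With this moment \<open>T N ^ p\<close> is at least N^4. A union over at most
    N^2 entries then still leaves N^-2, which is summable, and the mean shift is likewise
    O(N^-4).\<close>
  obtain p :: nat where p: "real p * (\<epsilon> / 2) \<ge> 4"
    using \<epsilon> reals_Archimedean3[of "\<epsilon> / 2"] by (metis half_gt_zero less_imp_le)
  have T1: "T N ^ p \<ge> real N ^ 4" "T N > 0" if "N \<ge> 1" for N
  proof -
    show "T N > 0" using that by (simp add: T_def)
    have "real N ^ 4 = real N powr 4" using that by simp
    also have "\<dots> \<le> real N powr (real p * (\<epsilon> / 2))" by (intro powr_mono p) (use that in simp)
    also have "\<dots> = T N ^ p" using that by (simp add: T_def powr_power mult.commute)
    finally show "T N ^ p \<ge> real N ^ 4" .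
  qed
  \<comment> \<open>The exponents balance as 2 (1/2 + eps) - 2 (eps/2) = 1 + eps.\<close>
  have sT: "(s N)\<^sup>2 / (68 * (T N)\<^sup>2) = real N powr (1 + \<epsilon>) / 68" if "N \<ge> 1" for N
  proof -
    have "(s N)\<^sup>2 = real N powr (1 + \<epsilon>) * (T N)\<^sup>2" using that
      by (simp add: s_def T_def powr_power powr_add[symmetric] algebra_simps)
    thus ?thesis using T1(2)[OF that] by simp
  qed
  define m where "m = (\<integral>x. \<bar>x\<bar> ^ p \<partial>D)"
  define m' where "m' = (\<integral>x. \<bar>x\<bar> ^ Suc p \<partial>D)"
  have m0: "m \<ge> 0" "m' \<ge> 0" by (simp_all add: m_def m'_def)
  define c where "c N = checker_coeff (k N)" for N
  define \<mu> where "\<mu> N = (\<integral>u. truncate (T N) u \<partial>D)" for N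
  define Large where "Large N = (\<Union>(i,j)\<in>upper_pairs N. {\<omega>\<in>space M. \<bar>a N i j \<omega>\<bar> > T N})" for N
  define Dev where "Dev N x = {\<omega>\<in>space M. \<bar>(\<Sum>(i,j)\<in>upper_pairs N. c N x (i,j) * truncate (T N) (a N i j \<omega>))
            - (\<Sum>p\<in>upper_pairs N. c N x p) * \<mu> N\<bar> \<ge> s N}" for N x
  define Bad where "Bad N = Large N \<union> (\<Union>x\<in>grid N. Dev N x)" for N
  have meas_Large: "Large N \<in> events" for N
    unfolding Large_def case_prod_beta using rv[of _ _ N]
    by (intro sets.finite_UN) auto
  have meas_Dev: "Dev N x \<in> events" for N x
  proof -
    have [measurable]: "(\<lambda>\<omega>. \<Sum>(i,j)\<in>upper_pairs N. c N x (i,j) * truncate (T N) (a N i j \<omega>)) \<in> borel_measurable M"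
      unfolding case_prod_beta using rv[of _ _ N]
      by (intro borel_measurable_sum borel_measurable_times borel_measurable_const measurable_compose[OF _ truncate_measurable]) auto
    show ?thesis unfolding Dev_def by measurable
  qed
  have meas_Bad: "Bad N \<in> events" for N
    unfolding Bad_def using meas_Large meas_Dev finite_grid by (intro sets.Un sets.finite_UN) auto
  have Bad_le: "prob (Bad N) \<le> m * (1 / (real N)\<^sup>2) + (8 * real N + 1) ^ N * (2 * exp (- (real N powr (1 + \<epsilon>) / 68)))"
    if N: "N \<ge> 2" for N
  proof -
    have "prob (Large N) \<le> (real N)\<^sup>2 * (m / T N ^ p)"
      unfolding Large_def m_def using N by (intro entries_tail rv ident mom T1) auto
    also have "\<dots> \<le> (real N)\<^sup>2 * (m / real N ^ 4)"
      using T1[of N] N m0 by (intro mult_left_mono divide_left_mono mult_pos_pos) auto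
    also have "\<dots> = m * (1 / (real N)\<^sup>2)" using N by (simp add: field_simps power2_eq_square power4_eq_xxxx)
    finally have 1: "prob (Large N) \<le> m * (1 / (real N)\<^sup>2)" .
    have "prob (\<Union>x\<in>grid N. Dev N x) \<le> (\<Sum>x\<in>grid N. prob (Dev N x))"
      using meas_Dev finite_grid by (intro finite_measure_subadditive_finite) auto
    also have "\<dots> \<le> real (card (grid N)) * (2 * exp (- (real N powr (1 + \<epsilon>) / 68)))"
    proof (rule sum_bounded_above)
      fix x assume x: "x \<in> grid N"
      have "prob (Dev N x) \<le> 2 * exp (- ((s N)\<^sup>2 / (68 * (T N)\<^sup>2)))"
        unfolding Dev_def c_def \<mu>_def using N
        by (intro truncated_quadratic_form_tail ind ident x T1) (auto simp: s_def)
      thus "prob (Dev N x) \<le> 2 * exp (- (real N powr (1 + \<epsilon>) / 68))" using sT[of N] N by simp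
    qed
    also have "\<dots> \<le> (8 * real N + 1) ^ N * (2 * exp (- (real N powr (1 + \<epsilon>) / 68)))"
    proof (rule mult_right_mono)
      have "real (card (grid N)) \<le> real ((8 * N + 1) ^ N)" using card_grid_le[of N] by (rule of_nat_mono)
      thus "real (card (grid N)) \<le> (8 * real N + 1) ^ N" by (simp add: add.commute)
    qed simp
    finally have 2: "prob (\<Union>x\<in>grid N. Dev N x) \<le> \<dots>" .
    have "prob (Bad N) \<le> prob (Large N) + prob (\<Union>x\<in>grid N. Dev N x)"
      unfolding Bad_def using meas_Large meas_Dev finite_grid
      by (intro measure_Un_le sets.finite_UN) auto
    with 1 2 show ?thesis by linarith
  qed
  have "eventually (\<lambda>N. norm (prob (Bad N)) \<le> (m + 1) * (1 / (real N)\<^sup>2)) sequentially"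
    using grid_union_bound_eventually[OF \<epsilon>] eventually_ge_at_top[of 2]
  proof eventually_elim
    case (elim N)
    thus ?case using Bad_le[of N] by (simp add: add_divide_distrib)
  qed
  moreover have "summable (\<lambda>N. (m + 1) * (1 / (real N)\<^sup>2))"
    by (intro summable_mult) (use inverse_power_summable[of 2, where 'a = real] in \<open>simp add: inverse_eq_divide\<close>)
  ultimately have "summable (\<lambda>N. prob (Bad N))" by (rule summable_comparison_test_ev)
  hence AE: "AE \<omega> in M. eventually (\<lambda>N. \<omega> \<in> space M - Bad N) sequentially"
    by (intro borel_cantelli_AE1 meas_Bad) (auto simp: less_top[symmetric])
  \<comment> \<open>The 3 is the loss from rounding to the grid, the 1 is the allowed deviation
    \<open>s N\<close>, and \<open>2 * m'\<close> bounds the mean shift caused by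
    truncation.\<close>
  define K where "K = 3 * (1 + 2 * m')"
  show thesis
  proof (rule that[of K])
    show "K \<ge> 0" using m0 by (simp add: K_def)
    show "AE \<omega> in M. \<forall>\<^sub>F N in sequentially. \<forall>w\<in>carrier_vec N.
       (checker_mat N (k N) (\<lambda>i j. a N i j \<omega>) *\<^sub>v w) \<bullet> (checker_mat N (k N) (\<lambda>i j. a N i j \<omega>) *\<^sub>v w)
         \<le> (K * real N powr (1/2 + \<epsilon>))\<^sup>2 * (w \<bullet> w)"
      using AE
    proof eventually_elim
      case (elim \<omega>)
      thus ?case using eventually_ge_at_top[of 1]
      proof eventually_elim
        case (elim N)
        let ?A = "checker_mat N (k N) (\<lambda>i j. a N i j \<omega>)"
        have N: "N \<ge> 1" by (rule elim)
        have \<omega>: "\<omega> \<in> space M" "\<omega> \<notin> Bad N" using elim by auto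
        have form: "\<bar>vec N x \<bullet> (?A *\<^sub>v vec N x)\<bar> \<le> (1 + 2 * m') * s N" if x: "x \<in> grid N" for x
        proof -
          have small: "\<bar>a N i j \<omega>\<bar> \<le> T N" if "(i, j) \<in> upper_pairs N" for i j
          proof (rule ccontr)
            assume "\<not> ?thesis"
            hence "\<omega> \<in> Large N" unfolding Large_def using that \<omega>(1) by (intro UN_I[of "(i, j)"]) auto
            thus False using \<omega>(2) by (simp add: Bad_def)
          qed
          have "(\<Sum>(i,j)\<in>upper_pairs N. c N x (i,j) * truncate (T N) (a N i j \<omega>)) = vec N x \<bullet> (?A *\<^sub>v vec N x)"
            unfolding quadratic_form_checker_mat c_def
            by (rule sum.cong) (use small in \<open>auto simp: truncate_def\<close>)
          moreover have "\<omega> \<notin> Dev N x" using \<omega>(2) x by (auto simp: Bad_def)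
          ultimately have "\<bar>vec N x \<bullet> (?A *\<^sub>v vec N x) - (\<Sum>p\<in>upper_pairs N. c N x p) * \<mu> N\<bar> \<le> s N"
            using \<omega>(1) by (simp add: Dev_def)
          moreover have "\<bar>(\<Sum>p\<in>upper_pairs N. c N x p) * \<mu> N\<bar> \<le> 2 * m'"
          proof -
            have "\<bar>\<mu> N\<bar> \<le> m' / T N ^ p"
              unfolding \<mu>_def m'_def by (rule mean_truncate_le[OF D mom mean T1(2)[OF N]])
            also have "\<dots> \<le> m' / real N ^ 4"
              using T1[of N] N m0 by (intro divide_left_mono mult_pos_pos) auto
            also have "\<dots> \<le> m' / real N ^ 2"
              using N m0 by (intro divide_left_mono mult_pos_pos power_increasing) auto
            finally have "\<bar>\<mu> N\<bar> \<le> m' / real N ^ 2" .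
            moreover have "\<bar>\<Sum>p\<in>upper_pairs N. c N x p\<bar> \<le> 2 * real N ^ 2"
              using order_trans[OF sum_abs checker_coeff_abs_sum[OF x]] by (simp add: c_def)
            ultimately have "\<bar>\<Sum>p\<in>upper_pairs N. c N x p\<bar> * \<bar>\<mu> N\<bar> \<le> (2 * real N ^ 2) * (m' / real N ^ 2)"
              by (intro mult_mono) auto
            thus ?thesis using N by (simp add: abs_mult)
          qed
          \<comment> \<open>The mean shift is bounded, so for N at least 1 it can be charged to the
            deviation scale.\<close>
          moreover have "2 * m' \<le> 2 * m' * s N"
          proof -
            have "1 \<le> s N" unfolding s_def using N \<epsilon> by (intro ge_one_powr_ge_zero) auto
            thus ?thesis using m0 by (simp add: mult_le_cancel_left1)
          qed
          ultimately show ?thesis unfolding distrib_right by linarith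
        qed
        show ?case
        proof
          fix w :: "real vec" assume "w \<in> carrier_vec N"
          have "3 * ((1 + 2 * m') * s N) = K * real N powr (1/2 + \<epsilon>)" by (simp add: K_def s_def)
          with quadratic_form_on_grid_bounds_norm[OF checker_mat_carrier transpose_checker_mat _ form \<open>w \<in> carrier_vec N\<close>] N
          show "(?A *\<^sub>v w) \<bullet> (?A *\<^sub>v w) \<le> (K * real N powr (1/2 + \<epsilon>))\<^sup>2 * (w \<bullet> w)"
            by (metis One_nat_def Suc_le_eq)
        qed
      qed
    qed
  qed
qed

subsection \<open>Spectrum of the perturbed matrix\<close>

lemma smult_mat_mult_vec:
  fixes A :: "'a :: comm_ring_1 mat"
  assumes "A \<in> carrier_mat m n" "v \<in> carrier_vec n"
  shows "(c \<cdot>\<^sub>m A) *\<^sub>v v = c \<cdot>\<^sub>v (A *\<^sub>v v)"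
  using assms by (intro eq_vecI) (auto simp: scalar_prod_def sum_distrib_left mult.assoc)

definition class_vec :: "nat \<Rightarrow> nat \<Rightarrow> nat \<Rightarrow> real vec" where
  "class_vec n k r = vec n (\<lambda>i. if i mod k = r then 1 else 0)"

lemma class_vec_carrier [simp]: "class_vec n k r \<in> carrier_vec n"
  by (simp add: class_vec_def)

lemma class_vec_scalar_prod:
  "class_vec n k r \<bullet> class_vec n k r' = (if r = r' then real (card {i. i < n \<and> i mod k = r}) else 0)"
proof -
  have "class_vec n k r \<bullet> class_vec n k r' = (\<Sum>i<n. if i mod k = r \<and> r = r' then 1 else 0)"
    by (auto simp: class_vec_def scalar_prod_def lessThan_atLeast0 intro!: sum.cong)
  thus ?thesis by (simp add: sum.If_cases Int_def)
qed

lemma class_card_bound: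
  assumes r: "r < k"
  shows "\<bar>real k * real (card {i. i < n \<and> i mod k = r}) - real n\<bar> \<le> real k"
proof -
  \<comment> \<open>This is (n - r)/k rounded up when r is at most n, and 0 otherwise: the number of
    \<open>m\<close> with \<open>m * k + r < n\<close>. Because r < k, the natural-number
    subtraction never cuts off.\<close>
  define q where "q = (n + k - 1 - r) div k"
  have "{i. i < n \<and> i mod k = r} = (\<lambda>m. m * k + r) ` {..<q}"
  proof -
    have lt: "m * k + r < n \<longleftrightarrow> m < q" for m
    proof -
      have "m < q \<longleftrightarrow> Suc m * k \<le> n + k - 1 - r"
        unfolding q_def using r by (simp add: Suc_le_eq[symmetric] less_eq_div_iff_mult_less_eq)
      also have "\<dots> \<longleftrightarrow> m * k + r < n" using r by auto
      finally show ?thesis by simp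
    qed
    have "i \<in> (\<lambda>m. m * k + r) ` {..<q}" if "i < n" "i mod k = r" for i
      using that lt[of "i div k"] by (intro image_eqI[of _ _ "i div k"]) auto
    thus ?thesis using lt r by auto
  qed
  hence "card {i. i < n \<and> i mod k = r} = q"
    using r by (simp add: card_image inj_on_def)
  moreover have "q * k \<le> n + k - 1 - r" unfolding q_def by simp
  moreover have "n + k - 1 - r < q * k + k" unfolding q_def using r
    by (metis add.commute div_mult_mod_eq mod_less_divisor nat_add_left_cancel_less not_less_zero zero_less_iff_neq_zero)
  ultimately have "k * card {i. i < n \<and> i mod k = r} \<le> n + k" "n \<le> k * card {i. i < n \<and> i mod k = r} + k"
    using r by (auto simp: mult.commute)
  hence "real (k * card {i. i < n \<and> i mod k = r}) \<le> real (n + k)"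
     "real n \<le> real (k * card {i. i < n \<and> i mod k = r} + k)"
    by (simp_all only: of_nat_le_iff)
  thus ?thesis by (simp add: abs_le_iff)
qed

lemma fib_block_mat_carrier [simp]: "fib_block_mat n k \<in> carrier_mat n n"
  by (simp add: fib_block_mat_def)

lemma fib_block_mat_mult:
  assumes "w \<in> carrier_vec n" "i < n"
  shows "(fib_block_mat n k *\<^sub>v w) $ i = real (fibF (i mod k + 1)) * (class_vec n k (i mod k) \<bullet> w)"
  using assms
  by (auto simp: fib_block_mat_def class_vec_def scalar_prod_def sum_distrib_left intro!: sum.cong)

lemma fib_block_mat_class_vec:
  assumes "r < k"
  shows "fib_block_mat n k *\<^sub>v class_vec n k r
     = (real (fibF (r + 1)) * real (card {i. i < n \<and> i mod k = r})) \<cdot>\<^sub>v class_vec n k r"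
proof (rule eq_vecI)
  fix i assume "i < dim_vec ((real (fibF (r + 1)) * real (card {i. i < n \<and> i mod k = r})) \<cdot>\<^sub>v class_vec n k r)"
  hence i: "i < n" by (simp add: class_vec_def)
  show "(fib_block_mat n k *\<^sub>v class_vec n k r) $ i =
    ((real (fibF (r + 1)) * real (card {i. i < n \<and> i mod k = r})) \<cdot>\<^sub>v class_vec n k r) $ i"
    unfolding fib_block_mat_mult[OF class_vec_carrier i] class_vec_scalar_prod
    using i by (auto simp: class_vec_def)
qed (simp add: class_vec_def fib_block_mat_def)

lemma transpose_checker_plus_fib:
  "transpose_mat (checker_mat n k a + c \<cdot>\<^sub>m fib_block_mat n k) = checker_mat n k a + c \<cdot>\<^sub>m fib_block_mat n k"
  by (rule eq_matI) (auto simp: checker_mat_def fib_block_mat_def min.commute max.commute)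

text \<open>Each row of the Fibonacci block matrix is a multiple of a class indicator, so
  orthogonality to the \<open>k\<close> indicators annihilates it; the general perturbation count
  applies with these as \<open>rs\<close>.\<close>

lemma bulk_eig_count:
  assumes L: "L \<ge> 0" "\<And>w. w \<in> carrier_vec n \<Longrightarrow> (checker_mat n k a *\<^sub>v w) \<bullet> (checker_mat n k a *\<^sub>v w) \<le> L\<^sup>2 * (w \<bullet> w)"
    and k: "k > 0"
  shows "n - k \<le> eig_count (checker_mat n k a + c \<cdot>\<^sub>m fib_block_mat n k) {x. \<bar>x\<bar> \<le> L}"
proof -
  define rs where "rs = map (class_vec n k) [0..<k]"
  have "n - length rs \<le> eig_count (checker_mat n k a + c \<cdot>\<^sub>m fib_block_mat n k) {x. \<bar>x\<bar> \<le> L}"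
  proof (rule eig_count_perturbation[OF _ _ transpose_checker_plus_fib L])
    fix w :: "real vec" assume w: "w \<in> carrier_vec n" and 0: "\<And>r. r \<in> set rs \<Longrightarrow> r \<bullet> w = 0"
    have "fib_block_mat n k *\<^sub>v w = 0\<^sub>v n"
    proof (rule eq_vecI)
      fix i assume "i < dim_vec (0\<^sub>v n :: real vec)"
      hence i: "i < n" by simp
      have "class_vec n k (i mod k) \<in> set rs" using k by (auto simp: rs_def)
      from 0[OF this] show "(fib_block_mat n k *\<^sub>v w) $ i = 0\<^sub>v n $ i"
        using i by (simp add: fib_block_mat_mult[OF w i])
    qed (simp add: fib_block_mat_def)
    thus "(c \<cdot>\<^sub>m fib_block_mat n k) *\<^sub>v w = 0\<^sub>v n" using w
      by (subst smult_mat_mult_vec[of _ n n]) auto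
  qed (auto simp: rs_def)
  thus ?thesis by (simp add: rs_def)
qed

text \<open>The indicator of a class is an exact eigenvector of the block part, with eigenvalue
  \<open>c\<close>, so as an approximate eigenvector of the sum its residual is just the
  checkerboard part, of relative size at most \<open>L\<close>. The second error term is the
  distance from \<open>c\<close> to n F, caused by class sizes that are not exactly n/k.\<close>

lemma outlier_eigenvalue:
  assumes L: "L \<ge> 0" "\<And>w. w \<in> carrier_vec n \<Longrightarrow> (checker_mat n k a *\<^sub>v w) \<bullet> (checker_mat n k a *\<^sub>v w) \<le> L\<^sup>2 * (w \<bullet> w)"
    and r: "r < k" "k \<le> n"
  shows "\<exists>e. eigenvalue (checker_mat n k a + real k \<cdot>\<^sub>m fib_block_mat n k) e \<and>
             \<bar>e - real n * real (fibF (r + 1))\<bar> \<le> L + real (fibF (r + 1)) * real k"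
proof -
  let ?M = "checker_mat n k a + real k \<cdot>\<^sub>m fib_block_mat n k"
  let ?v = "class_vec n k r"
  let ?s = "real (card {i. i < n \<and> i mod k = r})"
  let ?F = "real (fibF (r + 1))"
  define c where "c = real k * (?F * ?s)"
  have M: "?M \<in> carrier_mat n n" by simp
  obtain U d where "orthogonally_diagonalized ?M U d n"
    using symmetric_orthogonally_diagonalizedE[OF M transpose_checker_plus_fib] .
  then interpret orthogonally_diagonalized ?M U d n .
  \<comment> \<open>The class is nonempty because it contains the index \<open>r\<close> itself,
    which is below \<open>n\<close> by r < k and k \<le> n.\<close>
  have "?v $ r = 1" using r by (simp add: class_vec_def)
  hence nz: "?v \<noteq> 0\<^sub>v n" using r by auto
  have "?M *\<^sub>v ?v = checker_mat n k a *\<^sub>v ?v + c \<cdot>\<^sub>v ?v"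
    by (subst add_mult_distrib_mat_vec[of _ n n])
      (auto simp: smult_mat_mult_vec[of _ n n] fib_block_mat_class_vec[OF r(1)] smult_smult_assoc c_def)
  hence "?M *\<^sub>v ?v - c \<cdot>\<^sub>v ?v = checker_mat n k a *\<^sub>v ?v"
    by (auto intro!: eq_vecI simp: class_vec_def checker_mat_def)
  hence "\<exists>e. eigenvalue ?M e \<and> \<bar>e - c\<bar> \<le> L"
    by (intro eigenvalue_near[OF class_vec_carrier nz L(1)]) (simp add: L(2))
  then obtain e where e: "eigenvalue ?M e" "\<bar>e - c\<bar> \<le> L" by blast
  have "\<bar>c - real n * ?F\<bar> = ?F * \<bar>real k * ?s - real n\<bar>"
    by (subst abs_of_nonneg[of ?F, symmetric], simp, subst abs_mult[symmetric]) (simp add: c_def algebra_simps)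
  also have "\<dots> \<le> ?F * real k" by (intro mult_left_mono class_card_bound r) simp
  finally have "\<bar>e - real n * ?F\<bar> \<le> L + ?F * real k" using e(2) by linarith
  with e(1) show ?thesis by blast
qed

section \<open>From deterministic spectral estimates to almost sure asymptotics\<close>

theorem theoremG6:
  fixes P :: "'w measure"
    and D :: "real measure"
    and a :: "nat \<Rightarrow> nat \<Rightarrow> nat \<Rightarrow> 'w \<Rightarrow> real"
    and k :: "nat \<Rightarrow> nat"
    and \<epsilon> :: real
  assumes "prob_space P"
    and rv: "\<And>N i j. i < j \<Longrightarrow> j < N \<Longrightarrow> a N i j \<in> borel_measurable P"
    and indep: "prob_space.indep_vars P (\<lambda>_. borel) (\<lambda>(N, i, j). a N i j)
                  {(N, i, j). i < j \<and> j < N}"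
    and ident: "\<And>N i j. i < j \<Longrightarrow> j < N \<Longrightarrow> distr P borel (a N i j) = D"
    and moments: "\<And>m. integrable D (\<lambda>x. \<bar>x\<bar> ^ m)"
    and mean: "(\<integral>x. x \<partial>D) = 0"
    and var: "(\<integral>x. x\<^sup>2 \<partial>D) = 1"
    and k_pos: "\<And>N. N \<ge> 1 \<Longrightarrow> 0 < k N \<and> k N \<le> N"
    and k_mono: "\<And>N. N \<ge> 1 \<Longrightarrow> k N \<le> k (Suc N)"
    and k_inf: "filterlim k at_top sequentially"
    and k_sqrt: "(\<lambda>N. real (k N)) \<in> O(\<lambda>N. sqrt (real N))"
    and eps: "\<epsilon> > 0"
  shows
    "(AE \<omega> in P. \<exists>C. \<forall>\<^sub>F N in sequentially.
        N - k N \<le> eig_count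
          (checker_mat N (k N) (\<lambda>i j. a N i j \<omega>) + real (k N) \<cdot>\<^sub>m fib_block_mat N (k N))
          {x. \<bar>x\<bar> \<le> C * real N powr (1/2 + \<epsilon>)})
     \<and> (\<forall>n::nat. n \<ge> 1 \<longrightarrow> (AE \<omega> in P. \<exists>C. \<forall>\<^sub>F N in sequentially.
        \<exists>ev. eigenvalue
          (checker_mat N (k N) (\<lambda>i j. a N i j \<omega>) + real (k N) \<cdot>\<^sub>m fib_block_mat N (k N)) ev
          \<and> \<bar>ev - real N * real (fibF n)\<bar> \<le> C * real N powr (1/2 + \<epsilon>)))"
proof -
  interpret prob_space P by fact
  have ind: "indep_vars (\<lambda>_. borel) (\<lambda>(i, j). a N i j) (upper_pairs N)" for N
  proof -
    have "indep_vars (\<lambda>_. borel) (\<lambda>p. (\<lambda>(N, i, j). a N i j) (Pair N p)) (upper_pairs N)"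
      by (rule indep_vars_reindex, simp add: inj_on_def, rule indep_vars_subset[OF indep])
        (auto simp: upper_pairs_def)
    thus ?thesis by simp
  qed
  have ident': "distr P borel (a N i j) = D" if "(i, j) \<in> upper_pairs N" for N i j
    using that by (intro ident) (auto simp: upper_pairs_def)
  obtain K where K: "K \<ge> 0" and AE: "AE \<omega> in P. \<forall>\<^sub>F N in sequentially. \<forall>w\<in>carrier_vec N.
       (checker_mat N (k N) (\<lambda>i j. a N i j \<omega>) *\<^sub>v w) \<bullet> (checker_mat N (k N) (\<lambda>i j. a N i j \<omega>) *\<^sub>v w)
         \<le> (K * real N powr (1/2 + \<epsilon>))\<^sup>2 * (w \<bullet> w)"
    by (rule checker_mat_norm_bound[where k = k, OF ind ident' moments mean eps])
  show ?thesis
  proof (intro conjI allI impI)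
    show "AE \<omega> in P. \<exists>C. \<forall>\<^sub>F N in sequentially.
        N - k N \<le> eig_count
          (checker_mat N (k N) (\<lambda>i j. a N i j \<omega>) + real (k N) \<cdot>\<^sub>m fib_block_mat N (k N))
          {x. \<bar>x\<bar> \<le> C * real N powr (1/2 + \<epsilon>)}"
      using AE
    proof eventually_elim
      case (elim \<omega>)
      show ?case
      proof (rule exI[of _ K])
        show "\<forall>\<^sub>F N in sequentially. N - k N \<le> eig_count
          (checker_mat N (k N) (\<lambda>i j. a N i j \<omega>) + real (k N) \<cdot>\<^sub>m fib_block_mat N (k N))
          {x. \<bar>x\<bar> \<le> K * real N powr (1/2 + \<epsilon>)}"
          using elim eventually_ge_at_top[of 1]
        proof eventually_elim
          case (elim N)
          show ?case by (rule bulk_eig_count) (use elim K k_pos in auto)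
        qed
      qed
    qed
  next
    fix n :: nat assume n: "n \<ge> 1"
    obtain C where C: "\<forall>\<^sub>F N in sequentially. norm (real (k N)) \<le> C * norm (sqrt (real N))"
      using k_sqrt by (elim landau_o.bigE)
    show "AE \<omega> in P. \<exists>C. \<forall>\<^sub>F N in sequentially.
        \<exists>ev. eigenvalue
          (checker_mat N (k N) (\<lambda>i j. a N i j \<omega>) + real (k N) \<cdot>\<^sub>m fib_block_mat N (k N)) ev
          \<and> \<bar>ev - real N * real (fibF n)\<bar> \<le> C * real N powr (1/2 + \<epsilon>)"
      using AE
    proof eventually_elim
      case (elim \<omega>)
      \<comment> \<open>The n-th class exists only once \<open>k N\<close> has reached
        \<open>n\<close>; divergence of \<open>k\<close> guarantees this for all large N.\<close>
      have "\<forall>\<^sub>F N in sequentially. n \<le> k N" using k_inf by (simp add: filterlim_at_top)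
      with elim C eventually_ge_at_top[of 1]
      have "\<forall>\<^sub>F N in sequentially. \<exists>ev. eigenvalue
          (checker_mat N (k N) (\<lambda>i j. a N i j \<omega>) + real (k N) \<cdot>\<^sub>m fib_block_mat N (k N)) ev
          \<and> \<bar>ev - real N * real (fibF n)\<bar> \<le> (K + real (fibF n) * \<bar>C\<bar>) * real N powr (1/2 + \<epsilon>)"
      proof eventually_elim
        case (elim N)
        define L where "L = K * real N powr (1/2 + \<epsilon>)"
        \<comment> \<open>With indices starting at 0, the n-th class is the residue n - 1; since n
          is at least 1, \<open>n - 1 + 1\<close> gives back \<open>n\<close>.\<close>
        have "\<exists>e. eigenvalue (checker_mat N (k N) (\<lambda>i j. a N i j \<omega>) + real (k N) \<cdot>\<^sub>m fib_block_mat N (k N)) e \<and>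
             \<bar>e - real N * real (fibF (n - 1 + 1))\<bar> \<le> L + real (fibF (n - 1 + 1)) * real (k N)"
          by (rule outlier_eigenvalue) (use elim K k_pos n in \<open>auto simp: L_def\<close>)
        then obtain e where e: "eigenvalue (checker_mat N (k N) (\<lambda>i j. a N i j \<omega>) + real (k N) \<cdot>\<^sub>m fib_block_mat N (k N)) e"
             "\<bar>e - real N * real (fibF n)\<bar> \<le> L + real (fibF n) * real (k N)" using n by auto
        have "real (k N) \<le> C * sqrt (real N)" using elim by simp
        also have "sqrt (real N) = real N powr (1/2)" by (simp add: powr_half_sqrt)
        \<comment> \<open>The class-size error F_n k_N is O(N^(1/2)) for fixed n and is absorbed
          into the noise scale. The resulting constant depends on n through F_n, which is harmless
          since n is fixed.\<close>
        also have "C * real N powr (1/2) \<le> \<bar>C\<bar> * real N powr (1/2 + \<epsilon>)"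
          using elim eps by (intro mult_mono powr_mono) auto
        finally have "real (fibF n) * real (k N) \<le> real (fibF n) * (\<bar>C\<bar> * real N powr (1/2 + \<epsilon>))"
          by (intro mult_left_mono) auto
        hence "\<bar>e - real N * real (fibF n)\<bar> \<le> (K + real (fibF n) * \<bar>C\<bar>) * real N powr (1/2 + \<epsilon>)"
          using e(2) unfolding L_def by (simp add: algebra_simps)
        with e(1) show ?case by blast
      qed
      thus ?case by blast
    qed
  qed
qed

end
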